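(* Let $\mathcal{H}$ be a finite-dimensional complex Hilbert space and let $\rho_{12}$ be a bipartite fermionic state on $\mathcal{H}\otimes\mathcal{H}$. Then $$\mathrm{E}_{\mathrm f}(\rho_{12})\geq\ln 2,$$ and there is equality if and only if $\rho_{12}$ is a convex combination of pure-state Slater determinants, i.e. $\rho_{12}$ is fermionic separable. That is, the quantity $\mathrm{E}_{\mathrm f}^A(\rho_{12}):=\mathrm{E}_{\mathrm f}(\rho_{12})-\ln 2$ is a faithful measure of fermionic entanglement: it is non-negative on all bipartite fermionic states and vanishes exactly on the fermionic-separable ones. In particular, if $\rho_{12}$ is the $2$-particle reduced density matrix of an $N$-particle fermionic state, then $\mathrm{E}_{\mathrm f}(\rho_{12})\geq\ln 2$, and equality holds if and only if $\rho_{12}$ is fermionic separable.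
   Context: A density matrix is a positive semidefinite operator of trace $1$. An $N$-particle fermionic state on $\mathcal{H}$ is a density matrix on $\mathcal{H}^{\otimes N}$ supported on the antisymmetric subspace $\wedge^N\mathcal{H}$; a bipartite fermionic state is a $2$-particle fermionic state. The $2$-particle reduced density matrix of an $N$-particle fermionic state ($N\ge2$) is its partial trace over the last $N-2$ tensor factors. $S(\rho)=-\mathrm{Tr}(\rho\ln\rho)$ is the von Neumann entropy. The entanglement of formation of a density matrix $\rho_{12}$ on $\mathcal{H}_1\otimes\mathcal{H}_2$ is $$\mathrm{E}_{\mathrm f}(\rho_{12})=\inf\Big\{\sum_{j=1}^n\lambda_j\,S(\mathrm{Tr}_2\,\omega^j)\ :\ \rho_{12}=\sum_{j=1}^n\lambda_j\omega^j\Big\},$$ where the infimum is over all finite decompositions with $\lambda_j>0$, $\sum_j\lambda_j=1$, and each $\omega^j$ a state on $\mathcal{H}_1\otimes\mathcal{H}_2$, which may be taken to be a pure state; $\mathrm{Tr}_2$ is the partial trace over $\mathcal{H}_2$. Here $\mathcal{H}_1=\mathcal{H}_2=\mathcal{H}$. A (two-particle) pure-state Slater determinant is $|\Psi\rangle\langle\Psi|$ with $\Psi=\frac{1}{\sqrt2}(u\otimes v-v\otimes u)$ for orthonormal $u,v\in\mathcal{H}$. A bipartite fermionic state is fermionic separable if it is a convex combination of two-particle pure-state Slater determinants, and fermionic entangled otherwise. *)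

theory Defs
  imports "HOL-Analysis.Analysis" "HOL-Combinatorics.Permutations"
begin

(* The Hilbert space is complex ^ 'n with its standard inner product; operators are
   matrices in the standard basis.  H1 (x) H2 is complex ^ ('a * 'b).  Since a type cannot
   depend on N, the N-th tensor power is indexed by the basis labels
   e_(xs!0) (x) ... (x) e_(xs!(N-1)) for lists xs of length N: vectors are functions
   'n list => complex and operators are kernels 'n list => 'n list => complex, of which only
   the values on lists of length N are used. *)

definition density_on :: "'i set \<Rightarrow> ('i \<Rightarrow> 'i \<Rightarrow> complex) \<Rightarrow> bool" where
  "density_on I K \<longleftrightarrow>
     (\<forall>x. (\<Sum>i\<in>I. \<Sum>j\<in>I. cnj (x i) * K i j * x j) \<in> \<real>\<^sub>\<ge>\<^sub>0) \<and> (\<Sum>i\<in>I. K i i) = 1"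

definition density_matrix :: "complex ^ 'i ^ 'i \<Rightarrow> bool" where
  "density_matrix \<rho> \<longleftrightarrow> density_on UNIV (\<lambda>i j. \<rho> $ i $ j)"

definition partial_trace2 :: "complex ^ ('a::finite \<times> 'b::finite) ^ ('a \<times> 'b) \<Rightarrow> complex ^ 'a ^ 'a" where
  "partial_trace2 \<omega> = (\<chi> i j. \<Sum>k\<in>UNIV. \<omega> $ (i, k) $ (j, k))"


definition conj_transpose :: "complex ^ 'n ^ 'm \<Rightarrow> complex ^ 'm ^ 'n" where
  "conj_transpose A = (\<chi> i j. cnj (A $ j $ i))"

definition unitary_matrix :: "complex ^ 'n ^ 'n \<Rightarrow> bool" where
  "unitary_matrix U \<longleftrightarrow> conj_transpose U ** U = mat 1 \<and> U ** conj_transpose U = mat 1"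

definition diag_matrix :: "('n \<Rightarrow> real) \<Rightarrow> complex ^ 'n ^ 'n" where
  "diag_matrix d = (\<chi> i j. if i = j then complex_of_real (d i) else 0)"

(* Functional calculus; meaningful for Hermitian A only, where f(A) does not depend on the
   chosen diagonalization. *)
definition matrix_fun :: "(real \<Rightarrow> real) \<Rightarrow> complex ^ 'n ^ 'n \<Rightarrow> complex ^ 'n ^ 'n" where
  "matrix_fun f A = (THE B. \<exists>U d. unitary_matrix U \<and>
     A = U ** diag_matrix d ** conj_transpose U \<and>
     B = U ** diag_matrix (\<lambda>i. f (d i)) ** conj_transpose U)"

(* The usual convention 0 ln 0 = 0 holds because ln 0 is a real number in HOL. *)
definition vn_entropy :: "complex ^ 'n ^ 'n \<Rightarrow> real" where
  "vn_entropy \<rho> = - Re (trace (\<rho> ** matrix_fun ln \<rho>))"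

definition entanglement_of_formation ::
    "complex ^ ('a::finite \<times> 'b::finite) ^ ('a \<times> 'b) \<Rightarrow> real" where
  "entanglement_of_formation \<rho> =
     Inf {\<Sum>j<n. c j * vn_entropy (partial_trace2 (\<omega> j)) | (n::nat) c \<omega>.
       (\<forall>j<n. c j > 0 \<and> density_matrix (\<omega> j)) \<and> (\<Sum>j<n. c j) = 1 \<and>
       \<rho> = (\<Sum>j<n. c j *\<^sub>R \<omega> j)}"


definition antisymmetric :: "nat \<Rightarrow> ('n list \<Rightarrow> complex) \<Rightarrow> bool" where
  "antisymmetric N \<psi> \<longleftrightarrow> (\<forall>\<pi> xs. \<pi> permutes {..<N} \<and> length xs = N \<longrightarrow>
     \<psi> (permute_list \<pi> xs) = of_int (sign \<pi>) * \<psi> xs)"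

(* Being supported on the antisymmetric subspace is expressed by containment of the range. *)
definition fermionic_state :: "nat \<Rightarrow> ('n::finite list \<Rightarrow> 'n list \<Rightarrow> complex) \<Rightarrow> bool" where
  "fermionic_state N \<sigma> \<longleftrightarrow> density_on {xs. length xs = N} \<sigma> \<and>
     (\<forall>\<psi>. antisymmetric N (\<lambda>xs. \<Sum>ys | length ys = N. \<sigma> xs ys * \<psi> ys))"

definition bipartite_fermionic_state :: "complex ^ ('n::finite \<times> 'n) ^ ('n \<times> 'n) \<Rightarrow> bool" where
  "bipartite_fermionic_state \<rho> \<longleftrightarrow>
     fermionic_state 2 (\<lambda>xs ys. \<rho> $ (xs ! 0, xs ! 1) $ (ys ! 0, ys ! 1))"

definition two_particle_rdm ::
    "nat \<Rightarrow> ('n::finite list \<Rightarrow> 'n list \<Rightarrow> complex) \<Rightarrow> complex ^ ('n::finite \<times> 'n) ^ ('n \<times> 'n)" where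
  "two_particle_rdm N \<sigma> = (\<chi> p q. \<Sum>zs | length zs = N - 2.
     \<sigma> (fst p # snd p # zs) (fst q # snd q # zs))"


definition cinner :: "complex ^ 'n \<Rightarrow> complex ^ 'n \<Rightarrow> complex" where
  "cinner u v = (\<Sum>i\<in>UNIV. cnj (u $ i) * v $ i)"

definition tensor :: "complex ^ 'a \<Rightarrow> complex ^ 'b \<Rightarrow> complex ^ ('a::finite \<times> 'b::finite)" where
  "tensor u v = (\<chi> p. u $ fst p * v $ snd p)"

definition ketbra :: "complex ^ 'n \<Rightarrow> complex ^ 'n ^ 'n" where
  "ketbra \<psi> = (\<chi> i j. \<psi> $ i * cnj (\<psi> $ j))"

definition slater_determinants :: "(complex ^ ('n::finite \<times> 'n) ^ ('n \<times> 'n)) set" where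
  "slater_determinants = {ketbra ((1 / sqrt 2) *\<^sub>R (tensor u v - tensor v u)) | u v.
     cinner u u = 1 \<and> cinner v v = 1 \<and> cinner u v = 0}"

definition fermionic_separable :: "complex ^ ('n::finite \<times> 'n) ^ ('n \<times> 'n) \<Rightarrow> bool" where
  "fermionic_separable \<rho> \<longleftrightarrow> \<rho> \<in> convex hull slater_determinants"

definition antisymmetric_eof :: "complex ^ ('n::finite \<times> 'n) ^ ('n \<times> 'n) \<Rightarrow> real" where
  "antisymmetric_eof \<rho> = entanglement_of_formation \<rho> - ln 2"

end

(* For a fermionic state omega with one-particle marginal gamma, diagonalize gamma and write
   p_ab for the diagonal of omega in the induced product basis.  By antisymmetry p is symmetric
   with zero diagonal, so the eigenvalues d_a = sum_b p_ab of gamma satisfy d_a <= 1/2; hence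
   Tr gamma^2 <= 1/2, with equality only if two eigenvalues are 1/2 and the others 0, and then
   positivity and antisymmetry force omega to be a Slater determinant.  From ln x <= x - 1,
   S(gamma) >= ln 2 + g(omega) with g(omega) = 1 - 2 Tr gamma^2 >= 0.  This polynomial lower
   bound replaces any continuity property of the entropy: the graph of g over the fermionic
   states is compact, so its convex hull is closed, and E_f(rho) = ln 2 puts (rho, 0) into that
   hull, i.e. rho is a mixture of states with g = 0.  Every component of a decomposition of a
   fermionic state is fermionic because it has a smaller range. *)
theory Submission
  imports Defs
begin

section \<open>Positive semidefinite matrices\<close>

text \<open>The infimum ranges over decompositions of arbitrary length and is not attained a priori:
  the value \<open>ln 2\<close> only yields decompositions whose average entropies tend to
  \<open>ln 2\<close>, and the obstacle is the passage to a limit of these. Recording a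
  decomposition as a pair (rho, t), with t the average of g, puts all of them into one
  finite-dimensional compact set whatever their number of terms; as t is at most the average entropy
  minus \<open>ln 2\<close>, the pairs approach (rho, 0). The entropy bound is ln x \<le> x - 1 at x
  = 2d for each eigenvalue d, weighted by d. The tangent touches at d = 1/2 and the weight removes d
  = 0, so nothing is lost on the spectrum (1/2, 1/2, 0, ...), which is that of the marginal of a
  Slater determinant. Hence a mixture of Slater determinants is itself a decomposition of average
  entropy \<open>ln 2\<close>. Since \<open>matrix_fun\<close> is a definite description, every
  statement about entropy rests on the spectral theorem and on independence of the chosen
  diagonalization.\<close>

lemma cinner_add_right: "cinner x (y + z) = cinner x y + cinner x z"
  and cinner_add_left: "cinner (x + y) z = cinner x z + cinner y z"
  and cinner_diff_right: "cinner x (y - z) = cinner x y - cinner x z"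
  and cinner_scale_right: "cinner x (c *s y) = c * cinner x y"
  and cinner_scale_left: "cinner (c *s x) y = cnj c * cinner x y"
  by (simp_all add: cinner_def sum.distrib sum_subtractf sum_distrib_left algebra_simps)

lemma cinner_sum_right: "cinner x (\<Sum>i\<in>I. f i) = (\<Sum>i\<in>I. cinner x (f i))"
  unfolding cinner_def by (simp add: sum_distrib_left) (rule sum.swap)

lemma cnj_cinner: "cnj (cinner x y) = cinner y x"
  by (simp add: cinner_def mult.commute)

lemma Re_cinner: "Re (cinner x y) = inner x y"
  by (simp add: cinner_def inner_vec_def inner_complex_def)

lemma cinner_self: "cinner x x = of_real ((norm x)\<^sup>2)"
  using cnj_cinner[of x x] by (simp add: complex_eq_iff Re_cinner power2_norm_eq_inner)

lemma cinner_axis_left: "cinner (axis p c) y = cnj c * y $ p"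
proof -
  have "cinner (axis p c) y = (\<Sum>i\<in>UNIV. if i = p then cnj c * y $ p else 0)"
    unfolding cinner_def by (rule sum.cong) (auto simp: axis_def)
  then show ?thesis by simp
qed

lemma matrix_vector_mult_axis: "(A *v axis q c) $ p = A $ p $ q * c" for A :: "complex^'n^'m"
proof -
  have "(A *v axis q c) $ p = (\<Sum>i\<in>UNIV. if i = q then A $ p $ q * c else 0)"
    unfolding matrix_vector_mult_def vec_lambda_beta by (rule sum.cong) (auto simp: axis_def)
  then show ?thesis by simp
qed

lemma cinner_matrix: "cinner x (A *v y) = (\<Sum>i\<in>UNIV. \<Sum>j\<in>UNIV. cnj (x $ i) * A $ i $ j * y $ j)"
  by (simp add: cinner_def matrix_vector_mult_def sum_distrib_left mult.assoc)

lemma cinner_conj_transpose: "cinner x (A *v y) = cinner (conj_transpose A *v x) y"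
proof -
  have "cinner x (A *v y) = (\<Sum>j\<in>UNIV. \<Sum>i\<in>UNIV. cnj (x $ i) * A $ i $ j * y $ j)"
    unfolding cinner_matrix by (rule sum.swap)
  then show ?thesis
    by (simp add: cinner_def conj_transpose_def matrix_vector_mult_def sum_distrib_left
        sum_distrib_right mult_ac)
qed

text \<open>Membership in the nonnegative reals includes that the form is real, which over the
  complex numbers already makes the matrix Hermitian.\<close>

definition pos_semidef :: "complex ^ 'n ^ 'n \<Rightarrow> bool" where
  "pos_semidef A \<longleftrightarrow> (\<forall>x. cinner x (A *v x) \<in> \<real>\<^sub>\<ge>\<^sub>0)"

lemma density_matrix_iff:
  fixes A :: "complex^'n^'n"
  shows "density_matrix A \<longleftrightarrow> pos_semidef A \<and> trace A = 1"
proof -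
  have "(\<forall>x. (\<Sum>i\<in>UNIV. \<Sum>j\<in>UNIV. cnj (x i) * A $ i $ j * x j) \<in> \<real>\<^sub>\<ge>\<^sub>0) \<longleftrightarrow> pos_semidef A" (is "?L \<longleftrightarrow> _")
  proof
    assume L: ?L
    show "pos_semidef A" unfolding pos_semidef_def cinner_matrix
    proof
      fix x :: "complex^'n"
      show "(\<Sum>i\<in>UNIV. \<Sum>j\<in>UNIV. cnj (x $ i) * A $ i $ j * x $ j) \<in> \<real>\<^sub>\<ge>\<^sub>0"
        using L by (rule spec)
    qed
  next
    assume A: "pos_semidef A"
    show ?L
    proof
      fix x
      show "(\<Sum>i\<in>UNIV. \<Sum>j\<in>UNIV. cnj (x i) * A $ i $ j * x j) \<in> \<real>\<^sub>\<ge>\<^sub>0"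
        using A[unfolded pos_semidef_def, rule_format, of "vec_lambda x"] by (simp add: cinner_matrix)
    qed
  qed
  then show ?thesis by (simp add: density_matrix_def density_on_def trace_def)
qed

text \<open>Polarization: reality of the form at x + y relates the imaginary parts of the two mixed
  terms, and reality at x + iy relates their real parts.\<close>

lemma pos_semidef_hermitian:
  assumes "pos_semidef A"
  shows "conj_transpose A = A"
proof -
  have q: "Im (cinner x (A *v x)) = 0" for x
    using assms by (simp add: pos_semidef_def complex_nonneg_Reals_iff)
  have eq: "cinner x (A *v y) = cnj (cinner y (A *v x))" for x y
  proof -
    have "cinner (x + c *s y) (A *v (x + c *s y)) =
        cinner x (A *v x) + c * cinner x (A *v y) + cnj c * cinner y (A *v x) +
        cnj c * c * cinner y (A *v y)" for c
      by (simp add: matrix_vector_right_distrib cinner_add_left cinner_add_right cinner_scale_left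
          cinner_scale_right vector_scalar_commute distrib_left mult.assoc)
    note form = this
    have "Im (cinner x (A *v y)) + Im (cinner y (A *v x)) = 0"
      using q[of "x + 1 *s y"] q[of x] q[of y] unfolding form by simp
    moreover have "Re (cinner x (A *v y)) = Re (cinner y (A *v x))"
      using q[of "x + \<i> *s y"] q[of x] q[of y] unfolding form by simp
    ultimately show ?thesis by (simp add: complex_eq_iff)
  qed
  have "cnj (A $ j $ i) = A $ i $ j" for i j
    using eq[of "axis i 1" "axis j 1", symmetric] by (simp add: cinner_axis_left matrix_vector_mult_axis)
  then show ?thesis
    by (simp add: vec_eq_iff conj_transpose_def)
qed

lemma pos_semidef_cnj:
  assumes "pos_semidef A"
  shows "cnj (A $ i $ j) = A $ j $ i"
  using arg_cong[OF pos_semidef_hermitian[OF assms], of "\<lambda>M. M $ j $ i"]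
  by (simp add: conj_transpose_def)

text \<open>The linear term dominates for small t. The choice t = -a/M with M = |b| + 1 works for
  every sign of b and keeps M positive, giving the value -a^2/M as an upper bound.\<close>

lemma quadratic_nonneg_linear_zero:
  fixes a b :: real
  assumes "\<And>t. 0 \<le> 2 * t * a + t\<^sup>2 * b"
  shows "a = 0"
proof (rule ccontr)
  assume a: "a \<noteq> 0"
  define M where "M = \<bar>b\<bar> + 1"
  have M: "M > 0" "b \<le> M" by (auto simp: M_def)
  have "0 \<le> 2 * (- a / M) * a + (- a / M)\<^sup>2 * b" by (rule assms)
  also have "\<dots> \<le> 2 * (- a / M) * a + (- a / M)\<^sup>2 * M"
    using M by (intro add_left_mono mult_left_mono) auto
  also have "\<dots> = - a\<^sup>2 / M" using M by (simp add: field_simps power2_eq_square)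
  also have "\<dots> < 0" using a M by (simp add: divide_neg_pos)
  finally show False by simp
qed

text \<open>A minimizer of the form is perturbed in the direction w = By: at y + tw the form is
  2t|w|^2 plus a multiple of t^2, so nonnegativity for all real t forces w = 0. Nonnegativity is
  only asked on S, so that the lemma serves both semidefinite matrices and the orthogonal complement
  on which an eigenvector is sought.\<close>

lemma hermitian_form_zero:
  assumes herm: "conj_transpose B = B"
    and S: "\<And>t::real. y + t *\<^sub>R (B *v y) \<in> S"
    and nn: "\<And>x. x \<in> S \<Longrightarrow> 0 \<le> Re (cinner x (B *v x))"
    and 0: "Re (cinner y (B *v y)) = 0"
  shows "B *v y = 0"
proof -
  define w where "w = B *v y"
  have s: "cinner x (B *v z) = cinner (B *v x) z" for x z
    using cinner_conj_transpose[of x B z] herm by simp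
  have sc: "t *\<^sub>R w = complex_of_real t *s w" for t
    by (simp add: vec_eq_iff scaleR_conv_of_real[where 'a=complex])
  have "0 \<le> 2 * t * (norm w)\<^sup>2 + t\<^sup>2 * Re (cinner w (B *v w))" for t
  proof -
    have "Re (cinner w w) = (norm w)\<^sup>2" "Re (cinner y (B *v w)) = (norm w)\<^sup>2"
      by (simp_all add: s w_def[symmetric] cinner_self)
    then show ?thesis
      using nn[OF S[of t]] 0 unfolding w_def[symmetric] sc matrix_vector_right_distrib
        vector_scalar_commute
      by (simp add: w_def[symmetric] cinner_add_left cinner_add_right cinner_scale_left
        cinner_scale_right power2_eq_square algebra_simps)
  qed
  then have "(norm w)\<^sup>2 = 0" by (rule quadratic_nonneg_linear_zero)
  then show ?thesis by (simp add: w_def)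
qed

lemma pos_semidef_form_zero:
  assumes "pos_semidef A" "cinner y (A *v y) = 0"
  shows "A *v y = 0"
  using assms pos_semidef_hermitian[OF assms(1)]
  by (intro hermitian_form_zero[where S=UNIV]) (auto simp: pos_semidef_def complex_nonneg_Reals_iff)

lemma trace_similar:
  "trace (U ** A ** V) = trace (A ** (V ** U))" for A :: "complex^'n^'n"
  using trace_mul_sym[of U "A ** V"] by (simp add: matrix_mul_assoc)

section \<open>Spectral theorem and entropy\<close>

lemma mat_vector_mult: "mat c *v x = c *s x" for x :: "complex^'n"
proof -
  have "(mat c *v x) $ i = (\<Sum>j\<in>UNIV. if j = i then c * x $ i else 0)" for i
    unfolding matrix_vector_mult_def mat_def vec_lambda_beta by (rule sum.cong) auto
  then show ?thesis by (simp add: vec_eq_iff)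
qed

text \<open>The Rayleigh quotient is maximized over the unit sphere of the orthogonal complement W
  of V. W is invariant under A because V consists of eigenvectors and A is Hermitian, so the
  maximizer is an eigenvector of A itself.\<close>

lemma hermitian_eigenvector_orthogonal_to:
  fixes A :: "complex^'n^'n"
  assumes herm: "conj_transpose A = A" and "finite V" and card: "card V < CARD('n)"
    and eig: "\<And>v. v \<in> V \<Longrightarrow> \<exists>c. A *v v = c *s v"
  obtains x and d :: real
  where "cinner x x = 1" "\<And>v. v \<in> V \<Longrightarrow> cinner v x = 0" "A *v x = of_real d *s x"
proof -
  define W where "W = {x. \<forall>v\<in>V. cinner v x = 0}"
  \<comment> \<open>The available orthogonality theorem is real. Real orthogonality to both v and iv
    is complex orthogonality to v, and the at most 2 \<open>card V\<close> vectors cannot span a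
    space of real dimension 2 \<open>CARD('n)\<close>.\<close>
  define B where "B = V \<union> (\<lambda>v. \<i> *s v) ` V"
  have sc: "t *\<^sub>R w = complex_of_real t *s w" for t and w :: "complex^'n"
    by (simp add: vec_eq_iff scaleR_conv_of_real[where 'a=complex])
  have "finite B" using \<open>finite V\<close> by (simp add: B_def)
  then have "dim B \<le> card B" by (rule dim_le_card')
  also have "\<dots> \<le> card V + card V"
    unfolding B_def by (meson \<open>finite V\<close> add_left_mono card_Un_le card_image_le order_trans)
  also have "\<dots> < DIM(complex^'n)" using card by simp
  finally obtain z where z: "z \<noteq> 0" "\<And>y. y \<in> span B \<Longrightarrow> orthogonal z y"
    using orthogonal_to_subspace_exists by blast
  have "cinner v z = 0" if "v \<in> V" for v
  proof -
    have "inner v z = 0" "inner (\<i> *s v) z = 0"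
      using that z(2)[of v] z(2)[of "\<i> *s v"]
      by (auto simp: B_def span_base orthogonal_def inner_commute)
    then show ?thesis
      by (simp add: Re_cinner[symmetric] cinner_scale_left complex_eq_iff)
  qed
  then have zW: "z \<in> W" by (simp add: W_def)
  have W_scale: "c *s x \<in> W" if "x \<in> W" for c x
    using that by (simp add: W_def cinner_scale_right)
  have W_add: "x + y \<in> W" if "x \<in> W" "y \<in> W" for x y
    using that by (simp add: W_def cinner_add_right)
  have W_A: "A *v x \<in> W" if "x \<in> W" for x
  proof -
    have "cinner v (A *v x) = 0" if "v \<in> V" for v
    proof -
      obtain c where "A *v v = c *s v" using eig \<open>v \<in> V\<close> by blast
      then show ?thesis
        using \<open>x \<in> W\<close> \<open>v \<in> V\<close> cinner_conj_transpose[of v A x] herm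
        by (simp add: W_def cinner_scale_left)
    qed
    then show ?thesis by (simp add: W_def)
  qed
  have "closed W"
  proof -
    have "W = (\<Inter>v\<in>V. {x. cinner v x = 0})" by (auto simp: W_def)
    moreover have "closed {x. cinner v x = 0}" for v :: "complex^'n"
      unfolding cinner_def by (intro closed_Collect_eq continuous_intros)
    ultimately show ?thesis by auto
  qed
  then have "compact (sphere 0 1 \<inter> W)" by (intro compact_Int_closed) auto
  moreover have "(1 / norm z) *\<^sub>R z \<in> W" unfolding sc by (rule W_scale[OF zW])
  then have "(1 / norm z) *\<^sub>R z \<in> sphere 0 1 \<inter> W"
    using z(1) by simp
  moreover have "continuous_on (sphere 0 1 \<inter> W) (\<lambda>x. Re (cinner x (A *v x)))"
    unfolding cinner_matrix by (intro continuous_intros)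
  ultimately obtain y where y: "y \<in> sphere 0 1 \<inter> W"
    and ymax: "\<And>x. x \<in> sphere 0 1 \<inter> W \<Longrightarrow> Re (cinner x (A *v x)) \<le> Re (cinner y (A *v y))"
    using continuous_attains_sup[of "sphere 0 1 \<inter> W" "\<lambda>x. Re (cinner x (A *v x))"] by blast
  define d where "d = Re (cinner y (A *v y))"
  \<comment> \<open>Maximality of d makes the form of d - A nonnegative on W and zero at y, which is
    the situation of \<open>hermitian_form_zero\<close>.\<close>
  define B where "B = mat (of_real d) - A"
  have Bv: "B *v x = of_real d *s x - A *v x" for x
    unfolding B_def matrix_vector_mult_diff_rdistrib mat_vector_mult ..
  have y1: "cinner y y = 1" using y by (simp add: cinner_self)
  have "B *v y = 0"
  proof (rule hermitian_form_zero[where S=W])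
    have "cnj (A $ j $ i) = A $ i $ j" for i j
      using arg_cong[OF herm, of "\<lambda>M. M $ i $ j"] by (simp add: conj_transpose_def)
    then show "conj_transpose B = B"
      by (auto simp: B_def conj_transpose_def mat_def vec_eq_iff)
    have "B *v y = of_real d *s y + (-1) *s (A *v y)"
      by (simp add: Bv vec_eq_iff)
    moreover have "y \<in> W" using y by blast
    ultimately show "y + t *\<^sub>R (B *v y) \<in> W" for t
      unfolding sc by (simp only:) (intro W_add W_scale W_A)
    show "0 \<le> Re (cinner x (B *v x))" if x: "x \<in> W" for x
    proof (cases "x = 0")
      case False
      define r where "r = 1 / norm x"
      have "norm (r *\<^sub>R x) = 1" using False by (simp add: r_def)
      then have "of_real r *s x \<in> sphere 0 1 \<inter> W"
        using W_scale[OF x] by (simp add: sc)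
      then have "Re (cinner (of_real r *s x) (A *v (of_real r *s x))) \<le> d"
        unfolding d_def by (rule ymax)
      then have "r\<^sup>2 * Re (cinner x (A *v x)) \<le> d"
        by (simp add: vector_scalar_commute cinner_scale_left cinner_scale_right power2_eq_square mult.assoc)
      then show ?thesis
        using False by (simp add: Bv cinner_diff_right cinner_scale_right cinner_self r_def field_simps)
    qed (simp add: Bv cinner_def)
    show "Re (cinner y (B *v y)) = 0"
      by (simp add: Bv cinner_diff_right cinner_scale_right y1 d_def)
  qed
  then have "A *v y = of_real d *s y" by (simp add: Bv)
  with y y1 show thesis by (intro that[of y d]) (auto simp: W_def)
qed

section \<open>Unitary and diagonal matrices, diagonalization of Hermitian matrices\<close>

lemma unitary_matrixI: "conj_transpose U ** U = mat 1 \<Longrightarrow> unitary_matrix U"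
  by (simp add: unitary_matrix_def matrix_left_right_inverse)

lemma unitary_matrixD:
  assumes "unitary_matrix U"
  shows "conj_transpose U ** U = mat 1" "U ** conj_transpose U = mat 1"
    "A ** conj_transpose U ** U = A" "B ** U ** conj_transpose U = B"
  using assms by (simp_all add: unitary_matrix_def matrix_mul_assoc[symmetric])

lemma matrix_mult_diag: "(A ** diag_matrix d) $ i $ j = A $ i $ j * of_real (d j)"
proof -
  have "(A ** diag_matrix d) $ i $ j = (\<Sum>k\<in>UNIV. if k = j then A $ i $ j * of_real (d j) else 0)"
    unfolding matrix_matrix_mult_def diag_matrix_def vec_lambda_beta by (rule sum.cong) auto
  then show ?thesis by simp
qed

lemma diag_matrix_mult: "(diag_matrix d ** A) $ i $ j = of_real (d i) * A $ i $ j"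
proof -
  have "(diag_matrix d ** A) $ i $ j = (\<Sum>k\<in>UNIV. if k = i then of_real (d i) * A $ i $ j else 0)"
    unfolding matrix_matrix_mult_def diag_matrix_def vec_lambda_beta by (rule sum.cong) auto
  then show ?thesis by simp
qed

lemma diag_matrix_mult_diag: "diag_matrix d ** diag_matrix e = diag_matrix (\<lambda>i. d i * e i)"
  unfolding vec_eq_iff matrix_mult_diag by (simp add: diag_matrix_def)

lemma trace_diag_matrix: "trace (diag_matrix d) = of_real (\<Sum>i\<in>UNIV. d i)"
  by (simp add: trace_def diag_matrix_def)

lemma hermitian_diagonalization:
  fixes A :: "complex^'n^'n"
  assumes herm: "conj_transpose A = A"
  obtains U d where "unitary_matrix U" "A = U ** diag_matrix d ** conj_transpose U"
proof -
  \<comment> \<open>The induction runs over subsets of the index type, so that the orthonormal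
    eigenvectors come out labelled by \<open>'n\<close> and can serve directly as columns of
    U.\<close>
  have "\<exists>u (d::'n \<Rightarrow> real). \<forall>i\<in>S. A *v u i = of_real (d i) *s u i \<and>
      (\<forall>j\<in>S. cinner (u i) (u j) = (if i = j then 1 else 0))" for S :: "'n set"
  proof (induction S rule: finite_induct[OF finite])
    case (2 k S)
    then obtain u and d :: "'n \<Rightarrow> real"
      where u: "\<And>i. i \<in> S \<Longrightarrow> A *v u i = of_real (d i) *s u i"
        "\<And>i j. i \<in> S \<Longrightarrow> j \<in> S \<Longrightarrow> cinner (u i) (u j) = (if i = j then 1 else 0)"
      by blast
    have "card S < CARD('n)" using 2 by (metis UNIV_I finite_class.finite_UNIV psubsetI psubset_card_mono subset_UNIV)
    then have "card (u ` S) < CARD('n)"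
      using card_image_le[of S u] by simp
    then obtain x and e :: real where x: "cinner x x = 1" "\<And>v. v \<in> u ` S \<Longrightarrow> cinner v x = 0"
      "A *v x = of_real e *s x"
      by (rule hermitian_eigenvector_orthogonal_to[OF herm, rotated]) (use u in auto)
    have "cinner x (u i) = 0" if "i \<in> S" for i
      using x(2)[of "u i"] that cnj_cinner[of "u i" x] by simp
    then show ?case
      using u x 2(2) by (intro exI[of _ "u(k := x)"] exI[of _ "d(k := e)"]) auto
  qed simp
  from this[of UNIV] obtain u and d :: "'n \<Rightarrow> real"
    where u: "\<And>i. A *v u i = of_real (d i) *s u i"
        "\<And>i j. cinner (u i) (u j) = (if i = j then 1 else 0)"
      by auto
  define U where "U = (\<chi> p i. u i $ p)"
  have U: "unitary_matrix U"
    using u(2) by (intro unitary_matrixI)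
      (simp add: U_def vec_eq_iff matrix_matrix_mult_def conj_transpose_def mat_def cinner_def)
  have "(A ** U) $ p $ i = (A *v u i) $ p" for p i
    by (simp add: U_def matrix_matrix_mult_def matrix_vector_mult_def)
  then have "A ** U = U ** diag_matrix d"
    by (simp add: vec_eq_iff matrix_mult_diag u(1)) (simp add: U_def)
  then have "A = U ** diag_matrix d ** conj_transpose U"
    by (metis U unitary_matrixD(4))
  with U show thesis by (rule that)
qed

text \<open>Given two diagonalizations, the unitary W built from V and U intertwines the diagonal
  matrices of d and e. Thus its entry at (i, j) vanishes unless d j = e i, and therefore W also
  intertwines f(d) and f(e); this gives the uniqueness that the definite description
  requires.\<close>

lemma matrix_fun_diagonalized:
  fixes U :: "complex^'n^'n"
  assumes U: "unitary_matrix U"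
  shows "matrix_fun f (U ** diag_matrix d ** conj_transpose U) =
    U ** diag_matrix (\<lambda>i. f (d i)) ** conj_transpose U"
  unfolding matrix_fun_def
proof (rule the_equality)
  fix B
  assume "\<exists>V e. unitary_matrix V \<and>
    U ** diag_matrix d ** conj_transpose U = V ** diag_matrix e ** conj_transpose V \<and>
    B = V ** diag_matrix (\<lambda>i. f (e i)) ** conj_transpose V"
  then obtain V e where V: "unitary_matrix V"
    and eq: "U ** diag_matrix d ** conj_transpose U = V ** diag_matrix e ** conj_transpose V"
    and B: "B = V ** diag_matrix (\<lambda>i. f (e i)) ** conj_transpose V" by blast
  define W where "W = conj_transpose V ** U"
  have "W ** diag_matrix d = conj_transpose V ** (U ** diag_matrix d ** conj_transpose U) ** U"
    by (simp add: W_def matrix_mul_assoc unitary_matrixD[OF U])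
  also have "\<dots> = diag_matrix e ** W"
    unfolding eq by (simp add: W_def matrix_mul_assoc unitary_matrixD[OF V])
  finally have "W $ i $ j * of_real (d j) = of_real (e i) * W $ i $ j" for i j
    by (metis matrix_mult_diag diag_matrix_mult)
  then have "d j = e i \<or> W $ i $ j = 0" for i j
    by (metis mult.commute mult_cancel_left of_real_eq_iff)
  then have "W $ i $ j * of_real (f (d j)) = of_real (f (e i)) * W $ i $ j" for i j
    by (metis mult.commute mult_zero_left)
  then have "W ** diag_matrix (\<lambda>i. f (d i)) = diag_matrix (\<lambda>i. f (e i)) ** W"
    by (simp add: vec_eq_iff matrix_mult_diag diag_matrix_mult)
  then have "V ** (W ** diag_matrix (\<lambda>i. f (d i))) ** conj_transpose U =
    V ** (diag_matrix (\<lambda>i. f (e i)) ** W) ** conj_transpose U" by simp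
  then show "B = U ** diag_matrix (\<lambda>i. f (d i)) ** conj_transpose U"
    by (simp add: B W_def matrix_mul_assoc unitary_matrixD[OF U] unitary_matrixD[OF V])
qed (use U in blast)

lemma trace_diagonalized:
  assumes "unitary_matrix U"
  shows "trace (U ** diag_matrix d ** conj_transpose U) = of_real (\<Sum>i\<in>UNIV. d i)"
  by (simp add: trace_similar unitary_matrixD[OF assms] trace_diag_matrix del: of_real_sum)

lemma mult_diagonalized:
  assumes "unitary_matrix U"
  shows "(U ** diag_matrix d ** conj_transpose U) ** (U ** diag_matrix e ** conj_transpose U) =
    U ** diag_matrix (\<lambda>i. d i * e i) ** conj_transpose U"
proof -
  have "(U ** diag_matrix d ** conj_transpose U) ** (U ** diag_matrix e ** conj_transpose U) =
    U ** (diag_matrix d ** diag_matrix e) ** conj_transpose U"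
    by (simp add: matrix_mul_assoc unitary_matrixD[OF assms])
  then show ?thesis by (simp add: diag_matrix_mult_diag)
qed

section \<open>Entropy in terms of eigenvalues\<close>

lemma vn_entropy_diagonalized:
  assumes "unitary_matrix U"
  shows "vn_entropy (U ** diag_matrix d ** conj_transpose U) = - (\<Sum>i\<in>UNIV. d i * ln (d i))"
  by (simp add: vn_entropy_def matrix_fun_diagonalized[OF assms] mult_diagonalized[OF assms]
      trace_diagonalized[OF assms] del: of_real_sum of_real_mult)

lemma conj_transpose_conj_transpose [simp]: "conj_transpose (conj_transpose A) = A"
  by (simp add: conj_transpose_def vec_eq_iff)

text \<open>The form of the congruent matrix at x is that of A at Tx. T may be rectangular, as the
  partial trace requires.\<close>

lemma pos_semidef_congruence:
  assumes "pos_semidef A"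
  shows "pos_semidef (conj_transpose T ** A ** T)"
proof -
  have "cinner x ((conj_transpose T ** A ** T) *v x) = cinner (T *v x) (A *v (T *v x))" for x
    using cinner_conj_transpose[of x "conj_transpose T" "A *v (T *v x)"]
    by (simp add: matrix_vector_mul_assoc[symmetric])
  then show ?thesis using assms by (simp add: pos_semidef_def)
qed

lemma pos_semidef_diagonal:
  assumes "pos_semidef A"
  shows "Re (A $ i $ i) \<ge> 0" "Im (A $ i $ i) = 0"
  using assms[unfolded pos_semidef_def, rule_format, of "axis i 1"]
  by (simp_all add: cinner_axis_left matrix_vector_mult_axis complex_nonneg_Reals_iff)

lemma density_matrix_diagonalization:
  assumes "density_matrix A"
  obtains U d where "unitary_matrix U" "A = U ** diag_matrix d ** conj_transpose U"
    "\<And>i. d i \<ge> 0" "(\<Sum>i\<in>UNIV. d i) = 1"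
proof -
  have A: "pos_semidef A" "trace A = 1" using assms by (auto simp: density_matrix_iff)
  obtain U d where U: "unitary_matrix U" and eq: "A = U ** diag_matrix d ** conj_transpose U"
    using hermitian_diagonalization[OF pos_semidef_hermitian[OF A(1)]] .
  have "conj_transpose U ** A ** U = diag_matrix d"
    unfolding eq by (simp add: matrix_mul_assoc unitary_matrixD[OF U])
  then have "pos_semidef (diag_matrix d)" using pos_semidef_congruence[OF A(1)] by metis
  then have "d i \<ge> 0" for i
    using pos_semidef_diagonal(1)[of "diag_matrix d" i] by (simp add: diag_matrix_def)
  moreover have "(\<Sum>i\<in>UNIV. d i) = 1"
    using A(2) trace_diagonalized[OF U, of d] unfolding eq by (metis of_real_eq_1_iff)
  ultimately show thesis using that[OF U eq] by blast
qed

lemma vn_entropy_ge_purity: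
  assumes "density_matrix A"
  shows "vn_entropy A \<ge> ln 2 + (1 - 2 * Re (trace (A ** A)))"
proof -
  obtain U d where U: "unitary_matrix U" and eq: "A = U ** diag_matrix d ** conj_transpose U"
    and d: "\<And>i. d i \<ge> 0" "(\<Sum>i\<in>UNIV. d i) = 1"
    using density_matrix_diagonalization[OF assms] by blast
  \<comment> \<open>The logarithmic inequality at 2 \<open>d i\<close>, multiplied by
    \<open>d i\<close>; for a zero eigenvalue both sides vanish. Summing against total weight 1
    produces the purity.\<close>
  have "d i * (ln 2 + 1 - 2 * d i) \<le> - (d i * ln (d i))" for i
  proof (cases "d i = 0")
    case False
    then have pos: "d i > 0" using d(1)[of i] by simp
    then have "ln 2 + ln (d i) \<le> 2 * d i - 1"
      using ln_le_minus_one[of "2 * d i"] by (simp add: ln_mult)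
    then have "d i * (ln 2 + 1 - 2 * d i) \<le> d i * (- ln (d i))"
      using pos by (intro mult_left_mono) auto
    then show ?thesis by simp
  qed simp
  then have "(\<Sum>i\<in>UNIV. d i * (ln 2 + 1 - 2 * d i)) \<le> vn_entropy A"
    unfolding eq vn_entropy_diagonalized[OF U] sum_negf[symmetric] by (rule sum_mono)
  moreover have "(\<Sum>i\<in>UNIV. d i * (ln 2 + 1 - 2 * d i)) =
      (ln 2 + 1) * (\<Sum>i\<in>UNIV. d i) - 2 * (\<Sum>i\<in>UNIV. d i * d i)"
    by (simp add: sum_distrib_left sum_distrib_right sum_subtractf sum.distrib algebra_simps)
  moreover have "Re (trace (A ** A)) = (\<Sum>i\<in>UNIV. d i * d i)"
    unfolding eq mult_diagonalized[OF U] trace_diagonalized[OF U] by simp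
  ultimately show ?thesis using d(2) by simp
qed

lemma scaleR_matrix_mult: "(r *\<^sub>R A) ** B = r *\<^sub>R (A ** B)"
  and matrix_mult_scaleR: "A ** (r *\<^sub>R B) = r *\<^sub>R (A ** B)"
  for A :: "complex^'n^'m"
  by (simp_all add: vec_eq_iff matrix_matrix_mult_def scaleR_sum_right)

text \<open>The equation leaves only the eigenvalues 0 and 1/2, and for both of them -d ln d equals
  d ln 2; the trace condition sums this to \<open>ln 2\<close>.\<close>

lemma vn_entropy_half_projection:
  assumes "density_matrix A" "A ** A = (1/2) *\<^sub>R A"
  shows "vn_entropy A = ln 2"
proof -
  obtain U d where U: "unitary_matrix U" and eq: "A = U ** diag_matrix d ** conj_transpose U"
    and d: "\<And>i. d i \<ge> 0" "(\<Sum>i\<in>UNIV. d i) = 1"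
    using density_matrix_diagonalization[OF assms(1)] by blast
  have D: "diag_matrix d = conj_transpose U ** A ** U"
    unfolding eq by (simp add: matrix_mul_assoc unitary_matrixD[OF U])
  have "diag_matrix d ** diag_matrix d = conj_transpose U ** (A ** A) ** U"
    unfolding D by (simp add: matrix_mul_assoc unitary_matrixD[OF U])
  also have "\<dots> = (1/2) *\<^sub>R diag_matrix d"
    unfolding assms(2) D by (simp add: matrix_mult_scaleR scaleR_matrix_mult)
  finally have "diag_matrix (\<lambda>i. d i * d i) $ i $ i = ((1/2) *\<^sub>R diag_matrix d) $ i $ i" for i
    unfolding diag_matrix_mult_diag by simp
  then have "d i * d i = d i / 2" for i
    by (simp add: diag_matrix_def scaleR_conv_of_real[where 'a=complex] flip: of_real_mult of_real_divide)
  then have "d i * (d i - 1/2) = 0" for i by (simp add: right_diff_distrib)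
  then have d_cases: "d i = 0 \<or> d i = 1/2" for i by (metis eq_iff_diff_eq_0 mult_eq_0_iff)
  have "- (d i * ln (d i)) = d i * ln 2" for i
  proof (cases "d i = 0")
    case False
    then have "d i = 1/2" using d_cases by blast
    moreover have "ln (1/2 :: real) = - ln 2" by (simp add: ln_div)
    ultimately show ?thesis by (simp only: minus_mult_right minus_minus)
  qed simp
  then have "vn_entropy A = (\<Sum>i\<in>UNIV. d i) * ln 2"
    unfolding eq vn_entropy_diagonalized[OF U] by (simp add: sum_negf[symmetric] sum_distrib_right)
  then show ?thesis using d(2) by simp
qed

section \<open>One-particle marginals of antisymmetric states\<close>

lemma sum_UNIV_prod:
  "(\<Sum>p\<in>UNIV. f p) = (\<Sum>i\<in>UNIV. \<Sum>j\<in>UNIV. f (i, j))"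
  for f :: "'a::finite \<times> 'b::finite \<Rightarrow> 'c::comm_monoid_add"
  by (simp add: sum.cartesian_product)

text \<open>The range of \<open>A\<close> lies in the antisymmetric subspace.\<close>

definition row_antisymmetric :: "complex ^ 'm ^ ('n::finite \<times> 'n) \<Rightarrow> bool" where
  "row_antisymmetric A \<longleftrightarrow> (\<forall>i j q. A $ (i, j) $ q = - A $ (j, i) $ q)"

section \<open>Change of the one-particle basis on both factors\<close>

definition tensor_square :: "complex ^ 'n ^ 'n \<Rightarrow> complex ^ ('n::finite \<times> 'n) ^ ('n \<times> 'n)" where
  "tensor_square U = (\<chi> p q. U $ fst p $ fst q * U $ snd p $ snd q)"

lemma unitary_matrix_tensor_square:
  assumes "unitary_matrix U"
  shows "unitary_matrix (tensor_square U)"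
proof (rule unitary_matrixI)
  have "(conj_transpose (tensor_square U) ** tensor_square U) $ (i, j) $ (k, l) =
      (conj_transpose U ** U) $ i $ k * (conj_transpose U ** U) $ j $ l" for i j k l
    by (simp add: matrix_matrix_mult_def conj_transpose_def tensor_square_def sum_UNIV_prod
        sum_product mult_ac)
  then show "conj_transpose (tensor_square U) ** tensor_square U = mat 1"
    by (auto simp: vec_eq_iff unitary_matrixD[OF assms] mat_def)
qed

text \<open>The unitary on the traced-out factor cancels. The traced index k runs over the columns
  of U, so the relation that is needed is orthonormality of the rows.\<close>

lemma partial_trace2_tensor_square:
  assumes "unitary_matrix U"
  shows "partial_trace2 (conj_transpose (tensor_square U) ** \<omega> ** tensor_square U) =
    conj_transpose U ** partial_trace2 \<omega> ** U"
proof -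
  have ortho: "(\<Sum>k\<in>UNIV. cnj (U $ l $ k) * U $ n $ k) = (if l = n then 1 else 0)" for l n
    using arg_cong[OF unitary_matrixD(2)[OF assms], of "\<lambda>M. M $ n $ l"]
    by (auto simp: matrix_matrix_mult_def conj_transpose_def mat_def mult.commute)
  have "partial_trace2 (conj_transpose (tensor_square U) ** \<omega> ** tensor_square U) $ i $ j =
      (conj_transpose U ** partial_trace2 \<omega> ** U) $ i $ j" for i j
  proof -
    have "partial_trace2 (conj_transpose (tensor_square U) ** \<omega> ** tensor_square U) $ i $ j =
      (\<Sum>k\<in>UNIV. \<Sum>m\<in>UNIV. \<Sum>n\<in>UNIV. \<Sum>r\<in>UNIV. \<Sum>l\<in>UNIV.
        cnj (U $ r $ i) * \<omega> $ (r, l) $ (m, n) * U $ m $ j * (cnj (U $ l $ k) * U $ n $ k))"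
      by (simp add: partial_trace2_def matrix_matrix_mult_def conj_transpose_def tensor_square_def
          sum_UNIV_prod sum_distrib_left sum_distrib_right mult_ac)
    also have "\<dots> = (\<Sum>m\<in>UNIV. \<Sum>n\<in>UNIV. \<Sum>r\<in>UNIV. \<Sum>l\<in>UNIV. \<Sum>k\<in>UNIV.
        cnj (U $ r $ i) * \<omega> $ (r, l) $ (m, n) * U $ m $ j * (cnj (U $ l $ k) * U $ n $ k))"
      by ((subst sum.swap, rule sum.cong[OF refl])+) simp
    also have "\<dots> = (\<Sum>m\<in>UNIV. \<Sum>n\<in>UNIV. \<Sum>r\<in>UNIV. \<Sum>l\<in>UNIV.
        if l = n then cnj (U $ r $ i) * \<omega> $ (r, l) $ (m, n) * U $ m $ j else 0)"
      by (intro sum.cong refl) (simp add: sum_distrib_left[symmetric] ortho)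
    also have "\<dots> = (\<Sum>m\<in>UNIV. \<Sum>n\<in>UNIV. \<Sum>r\<in>UNIV.
        cnj (U $ r $ i) * \<omega> $ (r, n) $ (m, n) * U $ m $ j)"
      by simp
    also have "\<dots> = (\<Sum>m\<in>UNIV. \<Sum>r\<in>UNIV. \<Sum>n\<in>UNIV.
        cnj (U $ r $ i) * \<omega> $ (r, n) $ (m, n) * U $ m $ j)"
      by (intro sum.cong refl sum.swap)
    also have "\<dots> = (conj_transpose U ** partial_trace2 \<omega> ** U) $ i $ j"
      by (simp add: partial_trace2_def matrix_matrix_mult_def conj_transpose_def
          sum_distrib_left sum_distrib_right)
    finally show ?thesis .
  qed
  then show ?thesis by (simp add: vec_eq_iff)
qed

text \<open>Applying the same matrix to both factors commutes with exchanging them. The right factor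
  V is arbitrary because it acts on the column index only and so cannot enlarge the range.\<close>

lemma row_antisymmetric_tensor_square:
  assumes "row_antisymmetric \<omega>"
  shows "row_antisymmetric (conj_transpose (tensor_square U) ** \<omega> ** V)"
proof -
  have 1: "(conj_transpose (tensor_square U) ** \<omega>) $ (i, j) $ q =
     - (conj_transpose (tensor_square U) ** \<omega>) $ (j, i) $ q" for i j q
  proof -
    have "(conj_transpose (tensor_square U) ** \<omega>) $ (i, j) $ q =
       (\<Sum>k\<in>UNIV. \<Sum>l\<in>UNIV. cnj (U $ k $ i) * cnj (U $ l $ j) * \<omega> $ (k, l) $ q)" for i j
      by (simp add: matrix_matrix_mult_def conj_transpose_def tensor_square_def sum_UNIV_prod)
    note eq = this
    have "(\<Sum>k\<in>UNIV. \<Sum>l\<in>UNIV. cnj (U $ k $ i) * cnj (U $ l $ j) * \<omega> $ (k, l) $ q) =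
      (\<Sum>k\<in>UNIV. \<Sum>l\<in>UNIV. - (cnj (U $ l $ j) * cnj (U $ k $ i) * \<omega> $ (l, k) $ q))"
      using assms unfolding row_antisymmetric_def
      by (intro sum.cong refl) (metis mult.commute mult_minus_right)
    also have "\<dots> = - (\<Sum>k\<in>UNIV. \<Sum>l\<in>UNIV. cnj (U $ k $ j) * cnj (U $ l $ i) * \<omega> $ (k, l) $ q)"
      by (subst sum.swap) (simp add: sum_negf)
    finally show ?thesis unfolding eq .
  qed
  have "(conj_transpose (tensor_square U) ** \<omega> ** V) $ p $ q =
     (\<Sum>r\<in>UNIV. (conj_transpose (tensor_square U) ** \<omega>) $ p $ r * V $ r $ q)" for p q
    by (simp add: matrix_matrix_mult_def)
  then show ?thesis
    unfolding row_antisymmetric_def by (metis (no_types, lifting) "1" mult_minus_left sum.cong sum_negf)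
qed

section \<open>Positivity of marginals and of blocks\<close>

lemma pos_semidef_add: "pos_semidef A \<Longrightarrow> pos_semidef B \<Longrightarrow> pos_semidef (A + B)"
  by (simp add: pos_semidef_def matrix_vector_mult_add_rdistrib cinner_add_right)

lemma pos_semidef_sum: "(\<And>k. k \<in> K \<Longrightarrow> pos_semidef (A k)) \<Longrightarrow> pos_semidef (\<Sum>k\<in>K. A k)"
proof (induction K rule: infinite_finite_induct)
  case (insert k K)
  then show ?case by (simp add: pos_semidef_add)
qed (simp_all add: pos_semidef_def cinner_def)

lemma density_matrix_partial_trace2:
  assumes "density_matrix \<omega>"
  shows "density_matrix (partial_trace2 \<omega>)"
proof -
  \<comment> \<open>\<open>E k\<close> is the isometry x \<mapsto> x \<otimes> e_k; the partial
    trace is the sum over k of the congruences by these isometries, which makes its positivity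
    evident.\<close>
  define E :: "'b \<Rightarrow> complex^'a^('a \<times> 'b)" where "E = (\<lambda>k. \<chi> p j. if p = (j, k) then 1 else 0)"
  have 1: "(A ** E k) $ i $ j = A $ i $ (j, k)" for A :: "complex^('a \<times> 'b)^'c" and i j k
  proof -
    have "(A ** E k) $ i $ j = (\<Sum>p\<in>UNIV. if p = (j, k) then A $ i $ (j, k) else 0)"
      unfolding matrix_matrix_mult_def E_def vec_lambda_beta by (rule sum.cong) auto
    then show ?thesis by simp
  qed
  have 2: "(conj_transpose (E k) ** A) $ i $ j = A $ (i, k) $ j" for A :: "complex^'c^('a \<times> 'b)" and i j k
  proof -
    have "(conj_transpose (E k) ** A) $ i $ j = (\<Sum>p\<in>UNIV. if p = (i, k) then A $ (i, k) $ j else 0)"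
      unfolding matrix_matrix_mult_def conj_transpose_def E_def vec_lambda_beta by (rule sum.cong) auto
    then show ?thesis by simp
  qed
  have "partial_trace2 \<omega> = (\<Sum>k\<in>UNIV. conj_transpose (E k) ** \<omega> ** E k)"
    by (simp add: vec_eq_iff partial_trace2_def 1 2)
  moreover have "pos_semidef (conj_transpose (E k) ** \<omega> ** E k)" for k
    using assms by (intro pos_semidef_congruence) (simp add: density_matrix_iff)
  ultimately have "pos_semidef (partial_trace2 \<omega>)" by (simp add: pos_semidef_sum)
  moreover have "trace (partial_trace2 \<omega>) = trace \<omega>"
    by (simp add: trace_def partial_trace2_def sum_UNIV_prod)
  ultimately show ?thesis using assms by (simp add: density_matrix_iff)
qed

text \<open>A zero diagonal entry is a zero of the form at a basis vector, which the matrix must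
  then annihilate; this clears the column, and Hermiticity the row.\<close>

lemma pos_semidef_diagonal_zero:
  assumes "pos_semidef A" "A $ q $ q = 0"
  shows "A $ p $ q = 0" "A $ q $ p = 0"
proof -
  have "A *v axis q 1 = 0"
    using assms by (intro pos_semidef_form_zero) (auto simp: cinner_axis_left matrix_vector_mult_axis)
  then have "(A *v axis q 1) $ p = 0" for p by simp
  then have 1: "A $ p $ q = 0" for p by (simp add: matrix_vector_mult_axis)
  show "A $ p $ q = 0" by (rule 1)
  show "A $ q $ p = 0"
    using arg_cong[OF pos_semidef_hermitian[OF assms(1)], of "\<lambda>M. M $ q $ p"] 1
    by (simp add: conj_transpose_def)
qed

text \<open>The sum of the nonnegative terms d(1/2 - d) is exactly 1/2 minus the sum of squares. In
  the case of equality every term vanishes, so each d is 0 or 1/2, and total weight 1 leaves exactly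
  two halves.\<close>

lemma sum_squares_le_half:
  fixes d :: "'i::finite \<Rightarrow> real"
  assumes d: "\<And>i. 0 \<le> d i" "\<And>i. d i \<le> 1/2" "(\<Sum>i\<in>UNIV. d i) = 1"
  shows "(\<Sum>i\<in>UNIV. d i * d i) \<le> 1/2"
    and "(\<Sum>i\<in>UNIV. d i * d i) = 1/2 \<Longrightarrow>
      \<exists>a b. a \<noteq> b \<and> d a = 1/2 \<and> d b = 1/2 \<and> (\<forall>i. i \<noteq> a \<and> i \<noteq> b \<longrightarrow> d i = 0)"
proof -
  have nonneg: "0 \<le> d i * (1/2 - d i)" for i using d by simp
  have eq: "(\<Sum>i\<in>UNIV. d i * (1/2 - d i)) = 1/2 - (\<Sum>i\<in>UNIV. d i * d i)"
    using d(3) by (simp add: right_diff_distrib sum_subtractf sum_divide_distrib[symmetric])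
  have "0 \<le> (\<Sum>i\<in>UNIV. d i * (1/2 - d i))" by (intro sum_nonneg nonneg)
  then show "(\<Sum>i\<in>UNIV. d i * d i) \<le> 1/2" unfolding eq by simp
  assume "(\<Sum>i\<in>UNIV. d i * d i) = 1/2"
  then have "(\<Sum>i\<in>UNIV. d i * (1/2 - d i)) = 0" unfolding eq by simp
  then have "d i * (1/2 - d i) = 0" for i
    using nonneg by (simp add: sum_nonneg_eq_0_iff)
  then have cases: "d i = 0 \<or> d i = 1/2" for i by (metis eq_iff_diff_eq_0 mult_eq_0_iff)
  define S where "S = {i. d i = 1/2}"
  have "d i = (if i \<in> S then 1/2 else 0)" for i using cases[of i] by (auto simp: S_def)
  then have "(\<Sum>i\<in>UNIV. d i) = (\<Sum>i\<in>UNIV. if i \<in> S then 1/2 else 0)" by (intro sum.cong) auto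
  also have "\<dots> = real (card S) / 2" by (simp add: sum.If_cases)
  finally have "card S = 2" using d(3) by simp
  then obtain a b where "S = {a, b}" "a \<noteq> b" by (meson card_2_iff)
  then show "\<exists>a b. a \<noteq> b \<and> d a = 1/2 \<and> d b = 1/2 \<and> (\<forall>i. i \<noteq> a \<and> i \<noteq> b \<longrightarrow> d i = 0)"
    using cases unfolding S_def by (intro exI[of _ a] exI[of _ b]) blast
qed

text \<open>Reduces to a diagonal marginal. Both particles are rotated by the same U, since
  different rotations of the two factors would in general destroy antisymmetry.\<close>

lemma antisymmetric_diagonalization:
  fixes \<omega> :: "complex ^ ('n::finite \<times> 'n) ^ ('n \<times> 'n)"
  assumes dens: "density_matrix \<omega>" and asym: "row_antisymmetric \<omega>"
  obtains U d \<omega>' where "unitary_matrix U"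
    "\<omega> = tensor_square U ** \<omega>' ** conj_transpose (tensor_square U)"
    "density_matrix \<omega>'" "row_antisymmetric \<omega>'"
    "partial_trace2 \<omega> = U ** diag_matrix d ** conj_transpose U"
    "partial_trace2 \<omega>' = diag_matrix d"
proof -
  obtain U d where U: "unitary_matrix U"
    and eq: "partial_trace2 \<omega> = U ** diag_matrix d ** conj_transpose U"
    using density_matrix_diagonalization[OF density_matrix_partial_trace2[OF dens]] by blast
  define \<omega>' where "\<omega>' = conj_transpose (tensor_square U) ** \<omega> ** tensor_square U"
  note T = unitary_matrix_tensor_square[OF U]
  show thesis
  proof
    show "unitary_matrix U" by (fact U)
    show "partial_trace2 \<omega> = U ** diag_matrix d ** conj_transpose U" by (fact eq)
    show "\<omega> = tensor_square U ** \<omega>' ** conj_transpose (tensor_square U)"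
      by (simp add: \<omega>'_def matrix_mul_assoc unitary_matrixD[OF T])
    have "trace \<omega>' = trace \<omega>"
      by (simp add: \<omega>'_def trace_similar unitary_matrixD[OF T])
    then show "density_matrix \<omega>'"
      using dens by (simp add: density_matrix_iff \<omega>'_def pos_semidef_congruence)
    show "row_antisymmetric \<omega>'"
      unfolding \<omega>'_def by (rule row_antisymmetric_tensor_square[OF asym])
    show "partial_trace2 \<omega>' = diag_matrix d"
      unfolding \<omega>'_def partial_trace2_tensor_square[OF U] eq
      by (simp add: matrix_mul_assoc unitary_matrixD[OF U])
  qed
qed

text \<open>This is the exclusion principle: the whole weight d i sits in entries p i k with k
  \<noteq> i, and each of these also counts towards d k, so d i is at most the remaining weight 1 -
  d i.\<close>

lemma antisymmetric_diagonal:
  fixes \<omega> :: "complex ^ ('n::finite \<times> 'n) ^ ('n \<times> 'n)"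
  assumes dens: "density_matrix \<omega>" and asym: "row_antisymmetric \<omega>"
    and diag: "partial_trace2 \<omega> = diag_matrix d"
  obtains p where "\<And>i j. \<omega> $ (i, j) $ (i, j) = of_real (p i j)"
    "\<And>i j. 0 \<le> p i j" "\<And>i j. p i j = p j i" "\<And>i. p i i = 0"
    "\<And>i. d i = (\<Sum>j\<in>UNIV. p i j)" "(\<Sum>i\<in>UNIV. d i) = 1" "\<And>i. d i \<le> 1/2"
proof -
  define p where "p i j = Re (\<omega> $ (i, j) $ (i, j))" for i j
  have psd: "pos_semidef \<omega>" and tr: "trace \<omega> = 1" using dens by (simp_all add: density_matrix_iff)
  have p: "\<omega> $ (i, j) $ (i, j) = of_real (p i j)" for i j
    using pos_semidef_diagonal(2)[OF psd, of "(i, j)"] by (simp add: p_def complex_eq_iff)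
  have nonneg: "0 \<le> p i j" for i j unfolding p_def by (rule pos_semidef_diagonal[OF psd])
  have herm: "cnj (\<omega> $ r $ q) = \<omega> $ q $ r" for q r
    by (rule pos_semidef_cnj[OF psd])
  have swap: "\<omega> $ (i, j) $ q = - \<omega> $ (j, i) $ q" for i j q
    using asym unfolding row_antisymmetric_def by blast
  \<comment> \<open>Exchange in the row index, Hermitian conjugation, and a second exchange; the two
    signs cancel.\<close>
  have sym: "p i j = p j i" for i j
    using arg_cong[OF swap[of i j "(i, j)"], of Re] arg_cong[OF herm[of "(j, i)" "(i, j)"], of Re]
      arg_cong[OF swap[of i j "(j, i)"], of Re]
    by (simp add: p_def)
  have diag0: "p i i = 0" for i
    using arg_cong[OF swap[of i i "(i, i)"], of Re] by (simp add: p_def)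
  have row: "d i = (\<Sum>j\<in>UNIV. p i j)" for i
  proof -
    have "of_real (d i) = partial_trace2 \<omega> $ i $ i" by (simp add: diag diag_matrix_def)
    also have "\<dots> = of_real (\<Sum>j\<in>UNIV. p i j)" by (simp add: partial_trace2_def p)
    finally show ?thesis by (simp only: of_real_eq_iff)
  qed
  have "trace (partial_trace2 \<omega>) = 1"
    using density_matrix_partial_trace2[OF dens] by (simp add: density_matrix_iff)
  then have total: "(\<Sum>i\<in>UNIV. d i) = 1"
    by (simp add: diag trace_diag_matrix del: of_real_sum)
  have half: "d i \<le> 1/2" for i
  proof -
    have "d i = (\<Sum>k\<in>UNIV - {i}. p i k)"
      using diag0 by (simp add: row sum.remove[of UNIV i])
    \<comment> \<open>the first and second marginals of \<open>p\<close> agree\<close>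
    also have "\<dots> \<le> (\<Sum>k\<in>UNIV - {i}. d k)"
    proof (rule sum_mono)
      fix k
      have "p k i \<le> d k" unfolding row by (rule member_le_sum) (auto simp: nonneg)
      then show "p i k \<le> d k" by (simp add: sym)
    qed
    also have "\<dots> = 1 - d i" using total by (simp add: sum_diff1)
    finally show ?thesis by simp
  qed
  show thesis using that[OF p nonneg sym diag0 row total half] .
qed

lemma trace_square_diagonalized:
  assumes "unitary_matrix U"
  shows "Re (trace ((U ** diag_matrix d ** conj_transpose U) ** (U ** diag_matrix d ** conj_transpose U)))
    = (\<Sum>i\<in>UNIV. d i * d i)"
  unfolding mult_diagonalized[OF assms] trace_diagonalized[OF assms] by simp

lemma antisymmetric_purity_le_half:
  fixes \<omega> :: "complex ^ ('n::finite \<times> 'n) ^ ('n \<times> 'n)"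
  assumes dens: "density_matrix \<omega>" and asym: "row_antisymmetric \<omega>"
  shows "Re (trace (partial_trace2 \<omega> ** partial_trace2 \<omega>)) \<le> 1/2"
proof -
  obtain U d \<omega>' where U: "unitary_matrix U"
    and \<omega>': "density_matrix \<omega>'" "row_antisymmetric \<omega>'" "partial_trace2 \<omega>' = diag_matrix d"
    and eq: "partial_trace2 \<omega> = U ** diag_matrix d ** conj_transpose U"
    using antisymmetric_diagonalization[OF assms] by metis
  obtain p where "\<And>i j. \<omega>' $ (i, j) $ (i, j) = of_real (p i j)" "\<And>i j. 0 \<le> p i j"
    "\<And>i j. p i j = p j i" "\<And>i. p i i = 0" "\<And>i. d i = (\<Sum>j\<in>UNIV. p i j)"
    "(\<Sum>i\<in>UNIV. d i) = 1" "\<And>i. d i \<le> 1/2"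
    using antisymmetric_diagonal[OF \<omega>'] by metis
  then show ?thesis
    unfolding eq trace_square_diagonalized[OF U] by (intro sum_squares_le_half) (auto intro: sum_nonneg)
qed

section \<open>The equality case and Slater determinants\<close>

lemma matrix_mult_ketbra: "T ** ketbra \<psi> ** conj_transpose T = ketbra (T *v \<psi>)" for T :: "complex^'n^'m"
  by (simp add: vec_eq_iff ketbra_def matrix_matrix_mult_def matrix_vector_mult_def conj_transpose_def
      sum_distrib_left sum_distrib_right mult_ac) 

lemma complex_matrix_vector_mult_scaleR: "A *v (r *\<^sub>R x) = r *\<^sub>R (A *v x)" for A :: "complex^'n^'m"
  by (simp add: vec_eq_iff matrix_vector_mult_def scaleR_sum_right)

text \<open>In the eigenbasis of the marginal all diagonal weight lies on (a, b) and (b, a).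
  Positivity then clears every other row and column, and antisymmetry fixes the signs in the
  remaining 2 by 2 block, which has rank one.\<close>

lemma antisymmetric_purity_half_imp_slater:
  fixes \<omega> :: "complex ^ ('n::finite \<times> 'n) ^ ('n \<times> 'n)"
  assumes dens: "density_matrix \<omega>" and asym: "row_antisymmetric \<omega>"
    and half: "Re (trace (partial_trace2 \<omega> ** partial_trace2 \<omega>)) = 1/2"
  shows "\<omega> \<in> slater_determinants"
proof -
  obtain U d \<omega>' where U: "unitary_matrix U"
    and \<omega>_eq: "\<omega> = tensor_square U ** \<omega>' ** conj_transpose (tensor_square U)"
    and \<omega>': "density_matrix \<omega>'" "row_antisymmetric \<omega>'" "partial_trace2 \<omega>' = diag_matrix d"
    and eq: "partial_trace2 \<omega> = U ** diag_matrix d ** conj_transpose U"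
    using antisymmetric_diagonalization[OF assms(1,2)] by metis
  have psd: "pos_semidef \<omega>'" using \<omega>'(1) by (simp add: density_matrix_iff)
  obtain p where p: "\<And>i j. \<omega>' $ (i, j) $ (i, j) = of_real (p i j)"
    "\<And>i j. 0 \<le> p i j" "\<And>i j. p i j = p j i" "\<And>i. p i i = 0"
    and d: "\<And>i. d i = (\<Sum>j\<in>UNIV. p i j)" "(\<Sum>i\<in>UNIV. d i) = 1" "\<And>i. d i \<le> 1/2"
    using antisymmetric_diagonal[OF \<omega>'] by metis
  have d0: "0 \<le> d i" for i unfolding d by (intro sum_nonneg p)
  obtain a b where ab: "a \<noteq> b" "d a = 1/2" "\<And>i. i \<noteq> a \<Longrightarrow> i \<noteq> b \<Longrightarrow> d i = 0"
    using sum_squares_le_half(2)[OF d0 d(3,2)] half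
    unfolding eq trace_square_diagonalized[OF U] by blast
  have p_le: "p i j \<le> d i" for i j
    unfolding d by (rule member_le_sum) (auto simp: p)
  \<comment> \<open>A pair other than (a, b) and (b, a) either repeats an index, where p vanishes by
    antisymmetry, or contains an index of eigenvalue 0, which bounds p by 0.\<close>
  have p0: "p i j = 0" if "(i, j) \<noteq> (a, b)" "(i, j) \<noteq> (b, a)" for i j
  proof -
    have "i = j \<or> d i = 0 \<or> d j = 0" using that ab(3)[of i] ab(3)[of j] by auto
    then show ?thesis
      using p_le[of i j] p_le[of j i] p(2)[of i j] p(2)[of j i] p(3)[of i j] p(4)[of i] by auto
  qed
  have "d a = (\<Sum>j\<in>UNIV. if j = b then p a b else 0)"
    unfolding d by (rule sum.cong) (use p0[of a] ab(1) in auto)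
  then have pab: "p a b = 1/2" using ab(2) by simp
  have swap: "\<omega>' $ (i, j) $ q = - \<omega>' $ (j, i) $ q" for i j q
    using \<omega>'(2) unfolding row_antisymmetric_def by blast
  \<comment> \<open>The Slater vector of the basis vectors a and b; the unitary maps it to the
    Slater vector of the corresponding columns of U.\<close>
  define e where "e = (1 / sqrt 2) *\<^sub>R (axis (a, b) 1 - axis (b, a) 1 :: complex ^ ('n \<times> 'n))"
  have e: "e $ q = (if q = (a, b) then of_real (1 / sqrt 2) else if q = (b, a) then - of_real (1 / sqrt 2) else 0)" for q
    using ab(1) by (auto simp: e_def axis_def scaleR_conv_of_real[where 'a=complex])
  have half_eq: "complex_of_real (1 / sqrt 2) * complex_of_real (1 / sqrt 2) = of_real (1/2)"
    by (simp flip: of_real_mult)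
  have "\<omega>' $ q $ r = e $ q * cnj (e $ r)" for q r
  proof (cases "q \<in> {(a, b), (b, a)} \<and> r \<in> {(a, b), (b, a)}")
    case True
    have 1: "\<omega>' $ (a, b) $ (a, b) = of_real (1/2)" "\<omega>' $ (b, a) $ (b, a) = of_real (1/2)"
      using p(1,3) pab by metis+
    have 2: "\<omega>' $ (b, a) $ (a, b) = - of_real (1/2)" "\<omega>' $ (a, b) $ (b, a) = - of_real (1/2)"
      using swap[of b a "(a, b)"] swap[of a b "(b, a)"] 1 by simp_all
    show ?thesis using True 1 2 half_eq ab(1) by (elim conjE insertE) (simp_all add: e)
  next
    case False
    have "\<omega>' $ s $ s = 0" if "s \<notin> {(a, b), (b, a)}" for s
      using that p(1)[of "fst s" "snd s"] p0[of "fst s" "snd s"] by simp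
    then have "\<omega>' $ q $ r = 0" using False pos_semidef_diagonal_zero[OF psd] by blast
    moreover have "e $ s = 0" if "s \<notin> {(a, b), (b, a)}" for s
      using that unfolding e by simp
    then have "e $ q = 0 \<or> e $ r = 0" using False by blast
    ultimately show ?thesis by auto
  qed
  then have "\<omega>' = ketbra e" by (simp add: vec_eq_iff ketbra_def)
  then have \<omega>_ket: "\<omega> = ketbra (tensor_square U *v e)"
    unfolding \<omega>_eq by (simp add: matrix_mult_ketbra)
  define u where "u i = (\<chi> k. U $ k $ i)" for i
  have "tensor_square U *v axis (i, j) 1 = tensor (u i) (u j)" for i j
    by (simp add: vec_eq_iff matrix_vector_mult_axis tensor_square_def tensor_def u_def)
  then have "tensor_square U *v e = (1 / sqrt 2) *\<^sub>R (tensor (u a) (u b) - tensor (u b) (u a))"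
    unfolding e_def by (simp add: complex_matrix_vector_mult_scaleR matrix_vector_mult_diff_distrib)
  moreover have "cinner (u i) (u j) = (if i = j then 1 else 0)" for i j
    using arg_cong[OF unitary_matrixD(1)[OF U], of "\<lambda>M. M $ i $ j"]
    by (simp add: cinner_def u_def matrix_matrix_mult_def conj_transpose_def mat_def)
  ultimately show ?thesis
    unfolding slater_determinants_def \<omega>_ket using ab(1) by (intro CollectI exI[of _ "u a"] exI[of _ "u b"]) auto
qed

lemma pos_semidef_ketbra: "pos_semidef (ketbra \<psi>)"
proof -
  have "ketbra \<psi> *v x = cinner \<psi> x *s \<psi>" for x
    by (simp add: vec_eq_iff ketbra_def matrix_vector_mult_def cinner_def sum_distrib_left mult_ac)
  then have "cinner x (ketbra \<psi> *v x) = cinner x \<psi> * cnj (cinner x \<psi>)" for x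
    by (simp add: cinner_scale_right cnj_cinner)
  then show ?thesis
    by (simp add: pos_semidef_def complex_nonneg_Reals_iff complex_mult_cnj)
qed

text \<open>The marginal is half the projection onto the span of u and v: the mixed terms carry
  inner products of u with v and drop out. Its entropy is therefore \<open>ln 2\<close>, and Slater
  determinants attain the lower bound.\<close>

lemma slater_determinant:
  assumes "\<omega> \<in> slater_determinants"
  shows "density_matrix \<omega>" "row_antisymmetric \<omega>" "vn_entropy (partial_trace2 \<omega>) = ln 2"
proof -
  obtain u v where \<omega>: "\<omega> = ketbra ((1 / sqrt 2) *\<^sub>R (tensor u v - tensor v u))"
    and uv: "cinner u u = 1" "cinner v v = 1" "cinner u v = 0"
    using assms unfolding slater_determinants_def by blast
  have vu: "cinner v u = 0" using cnj_cinner[of u v] uv by simp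
  have half: "complex_of_real (1 / sqrt 2) * complex_of_real (1 / sqrt 2) = 1/2"
    by (simp flip: of_real_mult)
  have entry: "\<omega> $ (i, k) $ (j, l) =
      (u $ i * v $ k - v $ i * u $ k) * cnj (u $ j * v $ l - v $ j * u $ l) / 2" for i j k l
    using half by (simp add: \<omega> ketbra_def tensor_def scaleR_conv_of_real[where 'a=complex] field_simps)
  have pt: "partial_trace2 \<omega> = (1/2) *\<^sub>R (ketbra u + ketbra v)"
  proof -
    have "partial_trace2 \<omega> $ i $ j =
        (u $ i * cnj (u $ j) * cinner v v - u $ i * cnj (v $ j) * cinner u v
        - v $ i * cnj (u $ j) * cinner v u + v $ i * cnj (v $ j) * cinner u u) / 2" for i j
      unfolding partial_trace2_def vec_lambda_beta entry cinner_def sum_distrib_left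
        sum_subtractf[symmetric] sum.distrib[symmetric] sum_divide_distrib
      by (rule sum.cong) (simp_all add: algebra_simps)
    then show ?thesis
      by (simp add: vec_eq_iff uv vu ketbra_def scaleR_conv_of_real[where 'a=complex] field_simps)
  qed
  have tr: "trace (ketbra w) = cinner w w" for w :: "complex^'a"
    by (simp add: trace_def ketbra_def cinner_def mult.commute)
  have "trace (partial_trace2 \<omega>) = 1"
    by (simp add: pt trace_def ketbra_def sum.distrib[symmetric] scaleR_sum_right[symmetric])
      (simp add: sum.distrib uv tr[unfolded trace_def ketbra_def, simplified] scaleR_conv_of_real)
  moreover have "trace (partial_trace2 \<omega>) = trace \<omega>"
    by (simp add: trace_def partial_trace2_def sum_UNIV_prod)
  ultimately show dens: "density_matrix \<omega>"
    unfolding density_matrix_iff using pos_semidef_ketbra \<omega> by metis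
  show "row_antisymmetric \<omega>"
    unfolding row_antisymmetric_def split_paired_all split_paired_All entry by (simp add: field_simps)
  have add_matrix_mult: "(A + B) ** C = A ** C + B ** C" for A B C :: "complex^'a^'a"
    by (simp add: vec_eq_iff matrix_matrix_mult_def sum.distrib distrib_right)
  have kk: "ketbra x ** ketbra y = (\<chi> i j. cinner x y * (x $ i * cnj (y $ j)))" for x y :: "complex^'a"
    by (simp add: vec_eq_iff ketbra_def matrix_matrix_mult_def cinner_def sum_distrib_left sum_distrib_right mult_ac)
  have "(ketbra u + ketbra v) ** (ketbra u + ketbra v) = ketbra u + ketbra v"
    unfolding matrix_add_ldistrib add_matrix_mult kk
    by (simp add: uv vu)
      (simp add: ketbra_def vec_eq_iff)
  then have "partial_trace2 \<omega> ** partial_trace2 \<omega> = (1/2) *\<^sub>R partial_trace2 \<omega>"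
    unfolding pt scaleR_matrix_mult matrix_mult_scaleR by simp
  then show "vn_entropy (partial_trace2 \<omega>) = ln 2"
    by (rule vn_entropy_half_projection[OF density_matrix_partial_trace2[OF dens]])
qed

section \<open>Entanglement of formation\<close>

text \<open>The test vectors span the symmetric subspace, the orthogonal complement of the
  antisymmetric one. For a positive matrix a zero of the form is a vector of the kernel, and the
  kernel is orthogonal to the range. This version is linear in the state, so it can be split along a
  decomposition.\<close>

lemma row_antisymmetric_iff_form_zero:
  fixes \<omega> :: "complex ^ ('n::finite \<times> 'n) ^ ('n \<times> 'n)"
  assumes "pos_semidef \<omega>"
  shows "row_antisymmetric \<omega> \<longleftrightarrow>
    (\<forall>i j. cinner (axis (i, j) 1 + axis (j, i) 1) (\<omega> *v (axis (i, j) 1 + axis (j, i) 1)) = 0)"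
proof -
  have herm: "cnj (\<omega> $ r $ q) = \<omega> $ q $ r" for q r
    by (rule pos_semidef_cnj[OF assms])
  have col: "(\<omega> *v (axis (i, j) 1 + axis (j, i) 1)) $ q = \<omega> $ q $ (i, j) + \<omega> $ q $ (j, i)" for i j q
    by (simp add: matrix_vector_right_distrib matrix_vector_mult_axis)
  show ?thesis
  proof
    assume "row_antisymmetric \<omega>"
    then have swap: "\<omega> $ (i, j) $ q = - \<omega> $ (j, i) $ q" for i j q
      unfolding row_antisymmetric_def by blast
    show "\<forall>i j. cinner (axis (i, j) 1 + axis (j, i) 1) (\<omega> *v (axis (i, j) 1 + axis (j, i) 1)) = 0"
    proof (intro allI)
      fix i j
      show "cinner (axis (i, j) 1 + axis (j, i) 1) (\<omega> *v (axis (i, j) 1 + axis (j, i) 1)) = 0"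
        using swap[of i j "(i, j)"] swap[of i j "(j, i)"] by (simp add: cinner_add_left cinner_axis_left col)
    qed
  next
    assume *: "\<forall>i j. cinner (axis (i, j) 1 + axis (j, i) 1) (\<omega> *v (axis (i, j) 1 + axis (j, i) 1)) = 0"
    have "\<omega> $ (i, j) $ q = - \<omega> $ (j, i) $ q" for i j q
    proof -
      have "\<omega> *v (axis (i, j) 1 + axis (j, i) 1) = 0"
        by (rule pos_semidef_form_zero[OF assms]) (use * in blast)
      then have "\<omega> $ q $ (i, j) + \<omega> $ q $ (j, i) = 0" using col[of i j q] by simp
      then have "cnj (\<omega> $ q $ (i, j)) + cnj (\<omega> $ q $ (j, i)) = 0"
        by (simp flip: complex_cnj_add)
      then show ?thesis unfolding herm by (simp add: eq_neg_iff_add_eq_0)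
    qed
    then show "row_antisymmetric \<omega>" unfolding row_antisymmetric_def by blast
  qed
qed

text \<open>
  For \<open>\<rho>\<close> the form vanishes on \<open>e\<^sub>i \<otimes> e\<^sub>j + e\<^sub>j \<otimes> e\<^sub>i\<close>, and a vanishing sum of
  nonnegative terms vanishes termwise.
\<close>

lemma row_antisymmetric_component:
  fixes \<omega> :: "nat \<Rightarrow> complex ^ ('n::finite \<times> 'n) ^ ('n \<times> 'n)"
  assumes dens: "density_matrix \<rho>" and asym: "row_antisymmetric \<rho>"
    and \<omega>: "\<And>j. j < n \<Longrightarrow> c j > 0 \<and> density_matrix (\<omega> j)" and \<rho>: "\<rho> = (\<Sum>j<n. c j *\<^sub>R \<omega> j)"
    and k: "k < n"
  shows "row_antisymmetric (\<omega> k)"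
proof -
  have psd: "pos_semidef (\<omega> j)" if "j < n" for j using \<omega>[OF that] by (simp add: density_matrix_iff)
  have "cinner x (\<omega> k *v x) = 0" if "cinner x (\<rho> *v x) = 0" for x
  proof -
    have "(\<Sum>j<m. c j *\<^sub>R \<omega> j) *v x = (\<Sum>j<m. of_real (c j) *s (\<omega> j *v x))" for m
    proof (induction m)
      case (Suc m)
      have "(c m *\<^sub>R \<omega> m) *v x = of_real (c m) *s (\<omega> m *v x)"
        by (simp add: vec_eq_iff matrix_vector_mult_def scaleR_conv_of_real[where 'a=complex] sum_distrib_left mult_ac)
      then show ?case using Suc by (simp add: matrix_vector_mult_add_rdistrib)
    qed simp
    then have "cinner x (\<rho> *v x) = (\<Sum>j<n. of_real (c j) * cinner x (\<omega> j *v x))"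
      unfolding \<rho> by (simp add: cinner_sum_right cinner_scale_right)
    then have "(\<Sum>j<n. c j * Re (cinner x (\<omega> j *v x))) = 0"
      using arg_cong[OF that, of Re] by simp
    moreover have "0 \<le> c j * Re (cinner x (\<omega> j *v x))" if "j < n" for j
      using psd[OF that] \<omega>[OF that] by (simp add: pos_semidef_def complex_nonneg_Reals_iff)
    ultimately have "c k * Re (cinner x (\<omega> k *v x)) = 0"
      using k by (subst (asm) sum_nonneg_eq_0_iff) auto
    then show ?thesis
      using psd[OF k] \<omega>[OF k] by (auto simp: pos_semidef_def complex_nonneg_Reals_iff complex_eq_iff)
  qed
  moreover have "pos_semidef \<rho>" using dens by (simp add: density_matrix_iff)
  ultimately show ?thesis
    using asym unfolding row_antisymmetric_iff_form_zero[OF psd[OF k]] by (simp add: row_antisymmetric_iff_form_zero)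
qed

text \<open>The polynomial g, normalized to be added to \<open>ln 2\<close> with coefficient one. It
  can be negative outside the antisymmetric states, for instance -1 at a pure product state.\<close>

definition purity_defect :: "complex ^ ('n::finite \<times> 'n) ^ ('n \<times> 'n) \<Rightarrow> real" where
  "purity_defect \<omega> = 1 - 2 * Re (trace (partial_trace2 \<omega> ** partial_trace2 \<omega>))"

lemma continuous_on_purity_defect: "continuous_on S purity_defect"
  unfolding purity_defect_def[abs_def] trace_def matrix_matrix_mult_def partial_trace2_def vec_lambda_beta
  by (intro continuous_intros)

section \<open>Compactness of the state spaces\<close>

lemma compact_density_matrices: "compact {A :: complex^'n^'n. density_matrix A}"
proof -
  have "closed {A :: complex^'n^'n. density_matrix A}"
  proof -
    have "{A :: complex^'n^'n. density_matrix A} =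
        (\<Inter>x. {A. cinner x (A *v x) \<in> \<real>\<^sub>\<ge>\<^sub>0}) \<inter> {A. trace A = 1}"
      by (auto simp: density_matrix_iff pos_semidef_def)
    moreover have "closed {A :: complex^'n^'n. cinner x (A *v x) \<in> \<real>\<^sub>\<ge>\<^sub>0}" for x
    proof -
      have "continuous_on UNIV (\<lambda>A :: complex^'n^'n. cinner x (A *v x))"
        unfolding cinner_matrix by (intro continuous_intros)
      from closed_vimage[OF closed_nonneg_Reals_complex this] show ?thesis by (simp add: vimage_def)
    qed
    moreover have "closed {A :: complex^'n^'n. trace A = 1}"
      unfolding trace_def by (intro closed_Collect_eq continuous_intros)
    ultimately show ?thesis by (auto intro!: closed_Int closed_INT)
  qed
  moreover have "bounded {A :: complex^'n^'n. density_matrix A}"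
  proof (rule boundedI)
    fix A :: "complex^'n^'n"
    assume "A \<in> {A. density_matrix A}"
    then have A: "density_matrix A" by simp
    obtain U d where U: "unitary_matrix U" and eq: "A = U ** diag_matrix d ** conj_transpose U"
      and d: "\<And>i. d i \<ge> 0" "(\<Sum>i\<in>UNIV. d i) = 1"
      using density_matrix_diagonalization[OF A] by blast
    have herm: "cnj (A $ i $ j) = A $ j $ i" for i j
      using A by (intro pos_semidef_cnj) (simp add: density_matrix_iff)
    have mult: "A $ i $ j * A $ j $ i = of_real ((cmod (A $ i $ j))\<^sup>2)" for i j
      unfolding herm[of i j, symmetric] by (rule complex_norm_square[symmetric])
    \<comment> \<open>For Hermitian A the squared Euclidean norm is the trace of the square, hence
      the sum of the squared eigenvalues, which is at most their sum.\<close>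
    have "(norm A)\<^sup>2 = (\<Sum>i\<in>UNIV. \<Sum>j\<in>UNIV. (cmod (A $ i $ j))\<^sup>2)"
      by (simp add: power2_norm_eq_inner inner_vec_def)
    also have "\<dots> = Re (trace (A ** A))"
      by (simp add: trace_def matrix_matrix_mult_def mult del: of_real_power)
    also have "\<dots> = (\<Sum>i\<in>UNIV. d i * d i)"
      unfolding eq by (rule trace_square_diagonalized[OF U])
    also have "\<dots> \<le> (\<Sum>i\<in>UNIV. d i * 1)"
    proof (intro sum_mono mult_left_mono)
      show "d i \<le> 1" for i using member_le_sum[of i UNIV d] d by simp
    qed (rule d)
    finally show "norm A \<le> 1" using d(2) by (simp add: power_le_one_iff abs_square_le_1)
  qed
  ultimately show ?thesis by (simp add: compact_eq_bounded_closed)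
qed

lemma compact_antisymmetric_density_matrices:
  "compact {\<omega> :: complex ^ ('n::finite \<times> 'n) ^ ('n \<times> 'n). density_matrix \<omega> \<and> row_antisymmetric \<omega>}"
proof -
  have "closed {\<omega> :: complex ^ ('n \<times> 'n) ^ ('n \<times> 'n). row_antisymmetric \<omega>}"
    unfolding row_antisymmetric_def
    by (intro closed_Collect_all closed_Collect_eq continuous_intros)
  from compact_Int_closed[OF compact_density_matrices this] show ?thesis by (simp add: Collect_conj_eq)
qed

lemma purity_defect_antisymmetric:
  assumes "density_matrix \<omega>" "row_antisymmetric \<omega>"
  shows "purity_defect \<omega> \<ge> 0" "purity_defect \<omega> = 0 \<Longrightarrow> \<omega> \<in> slater_determinants"
    "vn_entropy (partial_trace2 \<omega>) \<ge> ln 2 + purity_defect \<omega>"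
  using antisymmetric_purity_le_half[OF assms] antisymmetric_purity_half_imp_slater[OF assms]
    vn_entropy_ge_purity[OF density_matrix_partial_trace2[OF assms(1)]]
  by (auto simp: purity_defect_def)

section \<open>From decompositions to the convex hull of a graph\<close>

definition decomposition_entropies :: "complex ^ ('a::finite \<times> 'b::finite) ^ ('a \<times> 'b) \<Rightarrow> real set" where
  "decomposition_entropies \<rho> = {\<Sum>j<n. c j * vn_entropy (partial_trace2 (\<omega> j)) | (n::nat) c \<omega>.
       (\<forall>j<n. c j > 0 \<and> density_matrix (\<omega> j)) \<and> (\<Sum>j<n. c j) = 1 \<and>
       \<rho> = (\<Sum>j<n. c j *\<^sub>R \<omega> j)}"

text \<open>Here t is the average of \<open>purity_defect\<close> over the components. Averaging the
  graph points with the same weights gives (\<rho>, t), while the entropy bound for each component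
  gives t \<le> s - \<open>ln 2\<close>; the length of the decomposition disappears in the
  hull.\<close>

lemma decomposition_entropy_bound:
  assumes dens: "density_matrix \<rho>" and asym: "row_antisymmetric \<rho>"
    and s: "s \<in> decomposition_entropies \<rho>"
  obtains t where "0 \<le> t" "t \<le> s - ln 2"
    "(\<rho>, t) \<in> convex hull ((\<lambda>\<omega>. (\<omega>, purity_defect \<omega>)) ` {\<omega>. density_matrix \<omega> \<and> row_antisymmetric \<omega>})"
proof -
  obtain n :: nat and c \<omega> where s_eq: "s = (\<Sum>j<n. c j * vn_entropy (partial_trace2 (\<omega> j)))"
    and *: "\<forall>j<n. c j > 0 \<and> density_matrix (\<omega> j)" and c: "(\<Sum>j<n. c j) = 1"
    and \<rho>: "\<rho> = (\<Sum>j<n. c j *\<^sub>R \<omega> j)"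
    using s unfolding decomposition_entropies_def by blast
  have \<omega>: "c j > 0 \<and> density_matrix (\<omega> j)" if "j < n" for j using * that by blast
  have as: "row_antisymmetric (\<omega> j)" if "j < n" for j
    by (rule row_antisymmetric_component[OF dens asym \<omega> \<rho> that])
  define t where "t = (\<Sum>j<n. c j * purity_defect (\<omega> j))"
  have pos: "0 \<le> c j" if "j < n" for j using \<omega>[OF that] by simp
  note pd = purity_defect_antisymmetric[OF conjunct2[OF \<omega>] as]
  show thesis
  proof
    show "0 \<le> t" unfolding t_def by (intro sum_nonneg mult_nonneg_nonneg) (auto intro: pos pd)
    have "ln 2 + t = (\<Sum>j<n. c j * (ln 2 + purity_defect (\<omega> j)))"
      using c by (simp add: t_def distrib_left sum.distrib sum_distrib_right[symmetric])
    also have "\<dots> \<le> s" unfolding s_eq by (intro sum_mono mult_left_mono) (auto intro: pos pd)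
    finally show "t \<le> s - ln 2" by simp
    have "(\<Sum>j<n. c j *\<^sub>R (\<omega> j, purity_defect (\<omega> j))) \<in>
        convex hull ((\<lambda>\<omega>. (\<omega>, purity_defect \<omega>)) ` {\<omega>. density_matrix \<omega> \<and> row_antisymmetric \<omega>})"
      by (rule convex_sum) (use c pos \<omega> as in \<open>auto intro!: hull_inc\<close>)
    moreover have "(\<Sum>j<n. c j *\<^sub>R (\<omega> j, purity_defect (\<omega> j))) = (\<rho>, t)"
      by (simp add: prod_eq_iff fst_sum snd_sum \<rho> t_def)
    ultimately show "(\<rho>, t) \<in> convex hull ((\<lambda>\<omega>. (\<omega>, purity_defect \<omega>)) `
        {\<omega>. density_matrix \<omega> \<and> row_antisymmetric \<omega>})" by simp
  qed
qed

lemma entanglement_of_formation_antisymmetric: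
  fixes \<rho> :: "complex ^ ('n::finite \<times> 'n) ^ ('n \<times> 'n)"
  assumes dens: "density_matrix \<rho>" and asym: "row_antisymmetric \<rho>"
  shows "entanglement_of_formation \<rho> \<ge> ln 2"
    and "entanglement_of_formation \<rho> = ln 2 \<longleftrightarrow> fermionic_separable \<rho>"
proof -
  let ?D = "decomposition_entropies \<rho>"
  let ?F = "{\<omega> :: complex ^ ('n \<times> 'n) ^ ('n \<times> 'n). density_matrix \<omega> \<and> row_antisymmetric \<omega>}"
  let ?K = "(\<lambda>\<omega>. (\<omega>, purity_defect \<omega>)) ` ?F"
  have eof: "entanglement_of_formation \<rho> = Inf ?D"
    unfolding entanglement_of_formation_def decomposition_entropies_def ..
  have ge: "ln 2 \<le> s" if "s \<in> ?D" for s
    using decomposition_entropy_bound[OF assms that] by (metis diff_ge_0_iff_ge order_trans)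
  then have bdd: "bdd_below ?D" by (rule bdd_belowI)
  \<comment> \<open>The one-term decomposition shows that the infimum is taken over a nonempty
    set.\<close>
  have "vn_entropy (partial_trace2 \<rho>) \<in> ?D"
    unfolding decomposition_entropies_def using dens
    by (intro CollectI exI[of _ 1] exI[of _ "\<lambda>_. 1"] exI[of _ "\<lambda>_. \<rho>"]) auto
  then have ne: "?D \<noteq> {}" by blast
  show bound: "entanglement_of_formation \<rho> \<ge> ln 2"
    unfolding eof by (rule cInf_greatest[OF ne ge])
  show "entanglement_of_formation \<rho> = ln 2 \<longleftrightarrow> fermionic_separable \<rho>"
  proof
    assume "entanglement_of_formation \<rho> = ln 2"
    then have inf: "Inf ?D = ln 2" by (simp add: eof)
    have "compact ?K"
      by (intro compact_continuous_image compact_antisymmetric_density_matrices continuous_on_Pair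
          continuous_on_id continuous_on_purity_defect)
    then have closed: "closed (convex hull ?K)" by (intro compact_imp_closed compact_convex_hull)
    \<comment> \<open>A decomposition of average entropy below \<open>ln 2\<close> + e gives a point
      (\<rho>, t) of the hull with 0 \<le> t < e. Its first component is exactly \<rho>, so only t
      has to converge.\<close>
    have "\<exists>z \<in> convex hull ?K. dist z (\<rho>, 0) < e" if "e > 0" for e
    proof -
      have "Inf ?D < ln 2 + e" using inf that by simp
      then obtain s where s: "s \<in> ?D" "s < ln 2 + e"
        using cInf_lessD[OF ne] by blast
      obtain t where "0 \<le> t" "t \<le> s - ln 2" "(\<rho>, t) \<in> convex hull ?K"
        using decomposition_entropy_bound[OF assms s(1)] .
      then show ?thesis using s(2) by (intro bexI[of _ "(\<rho>, t)"]) (auto simp: dist_Pair_Pair)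
    qed
    then have "(\<rho>, 0) \<in> convex hull ?K" using closed_approachable[OF closed] by blast
    then obtain S u where S: "finite S" "S \<subseteq> ?K" "\<forall>x\<in>S. 0 \<le> u x" "sum u S = 1"
      and eq: "(\<Sum>v\<in>S. u v *\<^sub>R v) = (\<rho>, 0)"
      unfolding convex_hull_explicit by blast
    have fst_eq: "(\<Sum>v\<in>S. u v *\<^sub>R fst v) = \<rho>" and snd_eq: "(\<Sum>v\<in>S. u v * snd v) = 0"
      using arg_cong[OF eq, of fst] arg_cong[OF eq, of snd] by (simp_all add: fst_sum snd_sum)
    have SK: "snd v = purity_defect (fst v)" "density_matrix (fst v)" "row_antisymmetric (fst v)"
      if "v \<in> S" for v using S(2) that by auto
    have nonneg: "0 \<le> u v * snd v" if "v \<in> S" for v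
      using S(3) that purity_defect_antisymmetric(1)[of "fst v"] SK[OF that] by simp
    have zero: "u v = 0 \<or> fst v \<in> slater_determinants" if "v \<in> S" for v
      using snd_eq sum_nonneg_eq_0_iff[OF S(1) nonneg] purity_defect_antisymmetric(2)[of "fst v"] SK[OF that] that
      by auto
    \<comment> \<open>Points of weight zero may have positive defect and are discarded; all others
      have defect 0 and are Slater determinants.\<close>
    let ?P = "{v \<in> S. u v \<noteq> 0}"
    have "(\<Sum>v\<in>?P. u v *\<^sub>R fst v) \<in> convex hull slater_determinants"
    proof (rule convex_sum)
      show "sum u ?P = 1"
        unfolding S(4)[symmetric] by (rule sum.mono_neutral_left) (use S(1) in auto)
    qed (use S zero in \<open>auto intro!: hull_inc\<close>)
    also have "(\<Sum>v\<in>?P. u v *\<^sub>R fst v) = \<rho>"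
      unfolding fst_eq[symmetric] by (rule sum.mono_neutral_left) (use S in auto)
    finally show "fermionic_separable \<rho>" by (simp add: fermionic_separable_def)
  next
    assume "fermionic_separable \<rho>"
    then obtain S u where S: "finite S" "S \<subseteq> slater_determinants" "\<forall>x\<in>S. 0 \<le> u x" "sum u S = 1"
      and eq: "(\<Sum>v\<in>S. u v *\<^sub>R v) = \<rho>"
      unfolding fermionic_separable_def convex_hull_explicit by blast
    \<comment> \<open>Decompositions demand strictly positive weights and are indexed by an initial
      segment of the naturals, whereas the hull provides nonnegative weights on a finite set; hence
      the restriction and the enumeration \<open>h\<close>.\<close>
    let ?P = "{v \<in> S. u v \<noteq> 0}"
    have P: "sum u ?P = 1" "(\<Sum>v\<in>?P. u v *\<^sub>R v) = \<rho>"
      unfolding S(4)[symmetric] eq[symmetric] by (rule sum.mono_neutral_left; use S in auto)+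
    obtain h where h: "bij_betw h {..<card ?P} ?P"
      using ex_bij_betw_nat_finite[of ?P] S(1) by (auto simp: atLeast0LessThan)
    have hP: "h j \<in> ?P" if "j < card ?P" for j using bij_betwE[OF h] that by blast
    have sl: "h j \<in> slater_determinants" "u (h j) > 0" if "j < card ?P" for j
      using hP[OF that] S(2,3) by (auto simp: less_le)
    have sums: "(\<Sum>j<card ?P. u (h j)) = 1" "(\<Sum>j<card ?P. u (h j) *\<^sub>R h j) = \<rho>"
      using P sum.reindex_bij_betw[OF h, of u] sum.reindex_bij_betw[OF h, of "\<lambda>v. u v *\<^sub>R v"] by auto
    have "(\<Sum>j<card ?P. u (h j) * vn_entropy (partial_trace2 (h j))) \<in> ?D"
      unfolding decomposition_entropies_def using sl slater_determinant(1) sums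
      by (intro CollectI exI[of _ "card ?P"] exI[of _ "\<lambda>j. u (h j)"] exI[of _ h]) auto
    moreover have "(\<Sum>j<card ?P. u (h j) * vn_entropy (partial_trace2 (h j))) =
        (\<Sum>j<card ?P. u (h j)) * ln 2"
      unfolding sum_distrib_right by (intro sum.cong) (use sl slater_determinant(3) in auto)
    ultimately have "ln 2 \<in> ?D" using sums(1) by simp
    then have "entanglement_of_formation \<rho> \<le> ln 2" unfolding eof by (rule cInf_lower[OF _ bdd])
    then show "entanglement_of_formation \<rho> = ln 2" using bound by simp
  qed
qed

section \<open>Reduced density matrices\<close>

lemma finite_lists_length: "finite {xs :: 'n::finite list. length xs = m}"
  using finite_lists_length_eq[of "UNIV :: 'n set" m] by simp

text \<open>Splits the N-th tensor power into the two kept particles and the N - 2 traced-out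
  ones.\<close>

lemma sum_lists_length:
  fixes f :: "'n::finite list \<Rightarrow> 'b::comm_monoid_add"
  assumes "2 \<le> N"
  shows "(\<Sum>xs | length xs = N. f xs) =
    (\<Sum>p\<in>UNIV. \<Sum>zs | length zs = N - 2. f (fst p # snd p # zs))"
proof -
  have "bij_betw (\<lambda>(p, zs). fst p # snd p # zs) (UNIV \<times> {zs. length zs = N - 2}) {xs :: 'n list. length xs = N}"
  proof (rule bij_betw_byWitness[where f'="\<lambda>xs. ((xs ! 0, xs ! 1), drop 2 xs)"])
    show "\<forall>xs\<in>{xs :: 'n list. length xs = N}.
        (\<lambda>(p, zs). fst p # snd p # zs) ((xs ! 0, xs ! 1), drop 2 xs) = xs"
    proof
      fix xs :: "'n list"
      assume "xs \<in> {xs. length xs = N}"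
      then obtain a b zs where "xs = a # b # zs"
        using assms by (cases xs; cases "tl xs") auto
      then show "(\<lambda>(p, zs). fst p # snd p # zs) ((xs ! 0, xs ! 1), drop 2 xs) = xs" by simp
    qed
  qed (use assms in auto)
  from sum.reindex_bij_betw[OF this, of f] show ?thesis
    by (simp add: sum.cartesian_product case_prod_unfold)
qed

lemma permute_list_transpose_Cons:
  "permute_list (Transposition.transpose 0 1) (j # i # zs) = i # j # zs"
proof (rule nth_equalityI)
  fix k
  assume k: "k < length (permute_list (Transposition.transpose 0 1) (j # i # zs))"
  have "Transposition.transpose 0 1 permutes {..<length (j # i # zs)}" by (rule permutes_swap_id) auto
  then have "permute_list (Transposition.transpose 0 1) (j # i # zs) ! k =
      (j # i # zs) ! Transposition.transpose 0 1 k"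
    using k by (intro permute_list_nth) auto
  also have "\<dots> = (i # j # zs) ! k"
    by (cases "k = 0"; cases "k = 1") (auto simp: transpose_def nth_Cons')
  finally show "permute_list (Transposition.transpose 0 1) (j # i # zs) ! k = (i # j # zs) ! k" .
qed simp

lemma nonneg_Reals_sum: "(\<And>i. i \<in> I \<Longrightarrow> f i \<in> \<real>\<^sub>\<ge>\<^sub>0) \<Longrightarrow> sum f I \<in> \<real>\<^sub>\<ge>\<^sub>0"
  by (induction I rule: infinite_finite_induct) (simp_all add: nonneg_Reals_add_I)

lemma two_particle_rdm_antisymmetric:
  fixes \<sigma> :: "'n::finite list \<Rightarrow> 'n list \<Rightarrow> complex"
  assumes N: "2 \<le> N" and \<sigma>: "fermionic_state N \<sigma>"
  shows "density_matrix (two_particle_rdm N \<sigma>)" "row_antisymmetric (two_particle_rdm N \<sigma>)"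
proof -
  let ?L = "{zs :: 'n list. length zs = N - 2}"
  have dens: "density_on {xs. length xs = N} \<sigma>" using \<sigma> by (simp add: fermionic_state_def)
  have delta: "(\<Sum>z\<in>?L. if z = zs then f z else 0) = f zs" if "zs \<in> ?L"
    for zs and f :: "'n list \<Rightarrow> complex"
    using that finite_lists_length[where 'n='n and m="N - 2"] by (simp add: sum.delta)
  have "(\<Sum>p\<in>UNIV. \<Sum>q\<in>UNIV. cnj (x p) * two_particle_rdm N \<sigma> $ p $ q * x q) \<in> \<real>\<^sub>\<ge>\<^sub>0" for x
  proof -
    have form: "(\<Sum>p\<in>UNIV. \<Sum>q\<in>UNIV. cnj (x p) * \<sigma> (fst p # snd p # zs) (fst q # snd q # zs) * x q) \<in> \<real>\<^sub>\<ge>\<^sub>0"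
      if zs: "zs \<in> ?L" for zs
    proof -
      \<comment> \<open>The vector x \<otimes> e_zs. The form of the reduced matrix at x is the sum
        over zs of the forms of \<sigma> at these vectors.\<close>
      define X where "X xs = (if drop 2 xs = zs then x (xs ! 0, xs ! 1) else 0)" for xs
      have "(\<Sum>xs | length xs = N. \<Sum>ys | length ys = N. cnj (X xs) * \<sigma> xs ys * X ys) =
         (\<Sum>p\<in>UNIV. \<Sum>z\<in>?L. if z = zs then
           (\<Sum>q\<in>UNIV. \<Sum>w\<in>?L. if w = zs then
             cnj (x p) * \<sigma> (fst p # snd p # z) (fst q # snd q # w) * x q else 0) else 0)"
        unfolding sum_lists_length[OF N]
        by (intro sum.cong refl) (auto simp: X_def intro!: sum.cong)
      also have "\<dots> = (\<Sum>p\<in>UNIV. \<Sum>q\<in>UNIV. cnj (x p) * \<sigma> (fst p # snd p # zs) (fst q # snd q # zs) * x q)"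
        unfolding delta[OF zs] ..
      finally show ?thesis using dens unfolding density_on_def by (elim conjE) (drule spec[of _ X], erule back_subst)
    qed
    have "(\<Sum>p\<in>UNIV. \<Sum>q\<in>UNIV. cnj (x p) * two_particle_rdm N \<sigma> $ p $ q * x q) =
      (\<Sum>p\<in>UNIV. \<Sum>q\<in>UNIV. \<Sum>zs\<in>?L. cnj (x p) * \<sigma> (fst p # snd p # zs) (fst q # snd q # zs) * x q)"
      by (simp add: two_particle_rdm_def sum_distrib_left sum_distrib_right)
    also have "\<dots> = (\<Sum>p\<in>UNIV. \<Sum>zs\<in>?L. \<Sum>q\<in>UNIV. cnj (x p) * \<sigma> (fst p # snd p # zs) (fst q # snd q # zs) * x q)"
      by (intro sum.cong refl sum.swap)
    also have "\<dots> = (\<Sum>zs\<in>?L. \<Sum>p\<in>UNIV. \<Sum>q\<in>UNIV. cnj (x p) * \<sigma> (fst p # snd p # zs) (fst q # snd q # zs) * x q)"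
      by (rule sum.swap)
    also have "\<dots> \<in> \<real>\<^sub>\<ge>\<^sub>0"
      by (rule nonneg_Reals_sum) (rule form)
    finally show ?thesis .
  qed
  moreover have "(\<Sum>p\<in>UNIV. two_particle_rdm N \<sigma> $ p $ p) = 1"
    using dens unfolding density_on_def sum_lists_length[OF N] by (simp add: two_particle_rdm_def)
  ultimately show "density_matrix (two_particle_rdm N \<sigma>)"
    by (simp add: density_matrix_def density_on_def)
  have swap: "\<sigma> (i # j # zs) y = - \<sigma> (j # i # zs) y" if "zs \<in> ?L" "length y = N" for i j zs y
  proof -
    \<comment> \<open>The range condition at the basis vector of label y isolates column y of
      \<sigma>; exchanging the first two particles then yields the sign -1.\<close>
    have "antisymmetric N (\<lambda>xs. \<Sum>ys | length ys = N. \<sigma> xs ys * (if ys = y then 1 else 0))"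
      using \<sigma>[unfolded fermionic_state_def, THEN conjunct2, THEN spec] .
    moreover have "(\<Sum>ys | length ys = N. \<sigma> xs ys * (if ys = y then 1 else 0)) = \<sigma> xs y" for xs
    proof -
      have "(\<Sum>ys | length ys = N. \<sigma> xs ys * (if ys = y then 1 else 0)) =
          (\<Sum>ys | length ys = N. if ys = y then \<sigma> xs y else 0)"
        by (intro sum.cong) auto
      then show ?thesis using that(2) finite_lists_length[where 'n='n and m=N] by (simp add: sum.delta)
    qed
    ultimately have "antisymmetric N (\<lambda>xs. \<sigma> xs y)" by simp
    moreover have "Transposition.transpose 0 1 permutes {..<N}"
      by (rule permutes_swap_id) (use N in auto)
    moreover have "length (j # i # zs) = N" using that(1) N by auto
    ultimately have "\<sigma> (permute_list (Transposition.transpose 0 1) (j # i # zs)) y =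
        of_int (sign (Transposition.transpose 0 (1::nat))) * \<sigma> (j # i # zs) y"
      unfolding antisymmetric_def by blast
    then show ?thesis unfolding permute_list_transpose_Cons by (simp add: sign_swap_id)
  qed
  have "two_particle_rdm N \<sigma> $ (i, j) $ q = - two_particle_rdm N \<sigma> $ (j, i) $ q" for i j q
    unfolding two_particle_rdm_def vec_lambda_beta sum_negf[symmetric]
    by (intro sum.cong refl, unfold fst_conv snd_conv, rule swap) (use N in auto)
  then show "row_antisymmetric (two_particle_rdm N \<sigma>)"
    unfolding row_antisymmetric_def by blast
qed

text \<open>For N = 2 nothing is traced out: the sum runs over the empty list alone. The bipartite
  case thus becomes the instance N = 2 of the statement on reduced matrices.\<close>

lemma as_two_particle_rdm:
  "\<rho> = two_particle_rdm 2 (\<lambda>xs ys. \<rho> $ (xs ! 0, xs ! 1) $ (ys ! 0, ys ! 1))"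
  by (simp add: two_particle_rdm_def vec_eq_iff)

theorem theorem4p1:
  fixes \<rho> :: "complex ^ ('n::finite \<times> 'n) ^ ('n \<times> 'n)"
  shows "(bipartite_fermionic_state \<rho> \<longrightarrow>
           entanglement_of_formation \<rho> \<ge> ln 2 \<and>
           (entanglement_of_formation \<rho> = ln 2 \<longleftrightarrow> fermionic_separable \<rho>) \<and>
           antisymmetric_eof \<rho> \<ge> 0 \<and>
           (antisymmetric_eof \<rho> = 0 \<longleftrightarrow> fermionic_separable \<rho>)) \<and>
         (\<forall>(N::nat) \<sigma>. N \<ge> 2 \<and> fermionic_state N \<sigma> \<and> \<rho> = two_particle_rdm N \<sigma> \<longrightarrow>
           entanglement_of_formation \<rho> \<ge> ln 2 \<and>
           (entanglement_of_formation \<rho> = ln 2 \<longleftrightarrow> fermionic_separable \<rho>))"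
proof -
  have rdm: "entanglement_of_formation \<rho> \<ge> ln 2"
      "entanglement_of_formation \<rho> = ln 2 \<longleftrightarrow> fermionic_separable \<rho>"
    if "2 \<le> N" "fermionic_state N \<sigma>" "\<rho> = two_particle_rdm N \<sigma>" for N \<sigma>
    using entanglement_of_formation_antisymmetric two_particle_rdm_antisymmetric[OF that(1,2)] that(3)
    by auto
  have "entanglement_of_formation \<rho> \<ge> ln 2"
      "entanglement_of_formation \<rho> = ln 2 \<longleftrightarrow> fermionic_separable \<rho>"
    if "bipartite_fermionic_state \<rho>"
    using rdm[OF order_refl that[unfolded bipartite_fermionic_state_def] as_two_particle_rdm] by auto
  with rdm show ?thesis by (auto simp: antisymmetric_eof_def)
qed

end
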